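(* Assume that $D_x,D_y$ are linear operators on real periodic grid functions satisfying the summation-by-parts identities $(D_xf,g)_h=-(f,D_xg)_h$ and $(D_yf,g)_h=-(f,D_yg)_h$ for all periodic grid functions $f,g$; let $\alpha\in(1,2]$, let $\Lambda_h^\alpha$ be the non-negative Fourier multiplier with symbol $|\bm{k}|^\alpha$, and let $\sigma\ge 0$. Let $\tau>0$ be arbitrary, let $\bm{B}_h^n\in (V_h^{\mathrm{per}})^3$, and let $\bm{B}_h^{n+1,*}=(B_{x,h}^{n+1,*},B_{y,h}^{n+1,*},B_{z,h}^{n+1,*})\in (V_h^{\mathrm{per}})^3$ and $\bm{B}_h^{n+1}$ satisfy one step of the scheme $$\frac{\bm{B}_h^{n+1,*}-\bm{B}_h^n}{\tau}+\mathcal{H}_h(\bm{B}_h^{n+1,*};\bm{B}_h^n)+\Lambda_h^\alpha\bm{B}_h^{n+1,*}+\sigma L_{b,h}\bm{B}_h^{n+1,*}=0,\qquad \bm{B}_h^{n+1}=P_h^{\mathrm{div}}\bm{B}_h^{n+1,*}.$$ Then $$\|\bm{B}_h^{n+1,*}\|_{0,h}^2+\|\bm{B}_h^{n+1,*}-\bm{B}_h^n\|_{0,h}^2+2\tau\|\Lambda_h^{\alpha/2}\bm{B}_h^{n+1,*}\|_{0,h}^2+2\tau\sigma\sum_{i=x,y,z}b_h(B_{i,h}^{n+1,*},B_{i,h}^{n+1,*})=\|\bm{B}_h^n\|_{0,h}^2.$$ Consequently, $$\|\bm{B}_h^{n+1}\|_{0,h}^2+2\tau\|\Lambda_h^{\alpha/2}\bm{B}_h^{n+1,*}\|_{0,h}^2+2\tau\sigma\sum_{i=x,y,z}b_h(B_{i,h}^{n+1,*},B_{i,h}^{n+1,*})\le\|\bm{B}_h^n\|_{0,h}^2.$$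 Thus the scheme is unconditionally stable (with no restriction on $\tau$ or $h$) in the magnetic $L^2$ energy $\|\cdot\|_{0,h}^2$.
   Context: Grid and spaces. $\Omega=[0,2\pi]^2$ with periodic boundary conditions carries a uniform $N\times N$ periodic grid of spacing $h=2\pi/N$ and a corresponding periodic triangulation $\mathcal{T}_h$ whose vertices are the grid points. $V_h^{\mathrm{per}}$ is the space of real, continuous, periodic, piecewise linear functions on $\mathcal{T}_h$; it is identified with real periodic grid functions through nodal values. $(f,g)_h$ is the periodic grid inner product ($h^2$ times the sum over grid points of the products of values), extended to vector fields by summing over components; $\|\cdot\|_{0,h}$ is the induced norm. Discrete curl and Hall operator. For $\bm{U}_h=(U_{x,h},U_{y,h},U_{z,h})\in (V_h^{\mathrm{per}})^3$, $$C_h\bm{U}_h:=(D_yU_{z,h},\,-D_xU_{z,h},\,D_xU_{y,h}-D_yU_{x,h}),$$ and for $\bm{U}_h,\bm{V}_h\in (V_h^{\mathrm{per}})^3$, $$\mathcal{H}_h(\bm{U}_h;\bm{V}_h):=C_h\bigl((C_h\bm{U}_h)\times\bm{V}_h\bigr),$$ with $\times$ the pointwise (at grid points) cross product in $\mathbb{R}^3$. Fractional Laplacian. For $s>0$, $\Lambda_h^s$ acts componentwise and multiplies the discrete Fourier coefficient at integer wavenumber $\bm{k}=(k_x,k_y)\in\{-N/2+1,\dots,N/2\}^2$ by $|\bm{k}|^s=(k_x^2+k_y^2)^{s/2}$; $\Lambda_h^{\alpha/2}$ is the multiplier with symbol $|\bm{k}|^{\alpha/2}$. Edge penalty. $\mathcal{E}_h$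 is the set of edges of $\mathcal{T}_h$ (all regarded as interior by periodicity); for $e\in\mathcal{E}_h$, $h_e$ is its length, $m_e$ its midpoint, $\bm{n}_e$ a unit normal and $\mathcal{K}_e$ the union of the two triangles sharing $e$. For $v_h\in V_h^{\mathrm{per}}$, let $w_h$ be the Morley finite element function (piecewise quadratic, continuous at vertices, normal derivatives continuous at edge midpoints) with $w_h(p)=v_h(p)$ at all vertices $p$ and $\frac{\partial w_h}{\partial\bm{n}_e}(m_e)=\bm{n}_e\cdot\frac{1}{|\mathcal{K}_e|}\int_{\mathcal{K}_e}\nabla v_h\,dx$ for all $e\in\mathcal{E}_h$. The recovered gradient is $G_hv_h|_T=\nabla w_h|_T$ on each $T\in\mathcal{T}_h$. The penalty form is $$b_h(u_h,v_h)=\sum_{e\in\mathcal{E}_h}h_e^{-1}\int_e[\![G_hu_h]\!]\cdot[\![G_hv_h]\!]\,ds,$$ with $[\![\cdot]\!]$ the jump across $e$. $L_{b,h}$ is the symmetric non-negative operator on $V_h^{\mathrm{per}}$ defined by $(L_{b,h}u_h,v_h)_h=b_h(u_h,v_h)$, applied componentwise to vector fields. Projection. $P_h^{\mathrm{div}}$ is the spectral Hodge projection: it maps the in-plane pair (the $x$ and $y$ components) onto discretely divergence-free in-plane fields (subtracting the gradient part) and leaves the $z$ component unchanged. It is an orthogonal projection with respect to $(\cdot,\cdot)_h$; in particular $\|P_h^{\mathrm{div}}\bm{U}_h\|_{0,h}\le\|\bm{U}_h\|_{0,h}$. *)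

theory Defs
  imports "HOL-Analysis.Analysis"
begin

section \<open>Periodic grid functions\<close>

text \<open>
  The grid point with index \<open>(i, j)\<close> is \<open>(i h, j h)\<close> with \<open>h = 2 \<pi> / N\<close>. Periodicity is
  expressed by working on the whole plane: indices range over all of \<open>\<int> \<times> \<int>\<close>, and grid functions
  are \<open>N\<close>-periodic in both indices. Elements of the finite element space are identified with
  grid functions through their nodal values; \<open>pl_interp\<close> below is the inverse
  identification.
\<close>

type_synonym index = "int \<times> int"

definition spacing :: "nat \<Rightarrow> real" where
  "spacing N = 2 * pi / real N"

definition pt :: "nat \<Rightarrow> index \<Rightarrow> real \<times> real" where
  "pt N p = (spacing N * of_int (fst p), spacing N * of_int (snd p))"

definition cell :: "nat \<Rightarrow> index set" where
  "cell N = {0..<int N} \<times> {0..<int N}"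

definition grid_functions :: "nat \<Rightarrow> (index \<Rightarrow> 'a) set" where
  "grid_functions N =
     {f. \<forall>i j. f (i + int N, j) = f (i, j) \<and> f (i, j + int N) = f (i, j)}"

text \<open>
  At type \<^typ>\<open>real\<close> this is the scalar inner product; at type \<^typ>\<open>real ^ 3\<close> it is the sum of
  the scalar inner products of the components.
\<close>

definition grid_inner :: "nat \<Rightarrow> (index \<Rightarrow> 'a::real_inner) \<Rightarrow> (index \<Rightarrow> 'a) \<Rightarrow> real" where
  "grid_inner N f g = (spacing N)\<^sup>2 * (\<Sum>p\<in>cell N. f p \<bullet> g p)"

definition grid_norm :: "nat \<Rightarrow> (index \<Rightarrow> 'a::real_inner) \<Rightarrow> real" where
  "grid_norm N f = sqrt (grid_inner N f f)"

definition grid_linear :: "nat \<Rightarrow> ((index \<Rightarrow> real) \<Rightarrow> (index \<Rightarrow> real)) \<Rightarrow> bool" where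
  "grid_linear N D \<longleftrightarrow>
     (\<forall>f\<in>grid_functions N. D f \<in> grid_functions N) \<and>
     (\<forall>f\<in>grid_functions N. \<forall>g\<in>grid_functions N. D (\<lambda>p. f p + g p) = (\<lambda>p. D f p + D g p)) \<and>
     (\<forall>c. \<forall>f\<in>grid_functions N. D (\<lambda>p. c * f p) = (\<lambda>p. c * D f p))"

definition summation_by_parts :: "nat \<Rightarrow> ((index \<Rightarrow> real) \<Rightarrow> (index \<Rightarrow> real)) \<Rightarrow> bool" where
  "summation_by_parts N D \<longleftrightarrow>
     (\<forall>f\<in>grid_functions N. \<forall>g\<in>grid_functions N.
        grid_inner N (D f) g = - grid_inner N f (D g))"

definition component :: "(index \<Rightarrow> real ^ 3) \<Rightarrow> 3 \<Rightarrow> index \<Rightarrow> real" where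
  "component U i = (\<lambda>p. U p $ i)"

definition componentwise ::
  "((index \<Rightarrow> real) \<Rightarrow> (index \<Rightarrow> real)) \<Rightarrow> (index \<Rightarrow> real ^ 3) \<Rightarrow> (index \<Rightarrow> real ^ 3)" where
  "componentwise F U = (\<lambda>p. \<chi> i. F (component U i) p)"


section \<open>Discrete curl and Hall operator\<close>

definition discrete_curl ::
  "((index \<Rightarrow> real) \<Rightarrow> (index \<Rightarrow> real)) \<Rightarrow> ((index \<Rightarrow> real) \<Rightarrow> (index \<Rightarrow> real)) \<Rightarrow>
   (index \<Rightarrow> real ^ 3) \<Rightarrow> (index \<Rightarrow> real ^ 3)" where
  "discrete_curl Dx Dy U =
     (\<lambda>p. vector [Dy (component U 3) p,
                  - Dx (component U 3) p,
                  Dx (component U 2) p - Dy (component U 1) p])"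

definition hall ::
  "((index \<Rightarrow> real) \<Rightarrow> (index \<Rightarrow> real)) \<Rightarrow> ((index \<Rightarrow> real) \<Rightarrow> (index \<Rightarrow> real)) \<Rightarrow>
   (index \<Rightarrow> real ^ 3) \<Rightarrow> (index \<Rightarrow> real ^ 3) \<Rightarrow> (index \<Rightarrow> real ^ 3)" where
  "hall Dx Dy U V = discrete_curl Dx Dy (\<lambda>p. cross3 (discrete_curl Dx Dy U p) (V p))"


section \<open>Fourier multipliers\<close>

definition wavenumbers :: "nat \<Rightarrow> index set" where
  "wavenumbers N = {- (int N div 2) + 1..int N div 2} \<times> {- (int N div 2) + 1..int N div 2}"

definition phase :: "nat \<Rightarrow> index \<Rightarrow> index \<Rightarrow> real" where
  "phase N k p = of_int (fst k) * fst (pt N p) + of_int (snd k) * snd (pt N p)"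

definition dft :: "nat \<Rightarrow> (index \<Rightarrow> real) \<Rightarrow> index \<Rightarrow> complex" where
  "dft N f k = (\<Sum>p\<in>cell N. of_real (f p) * cis (- phase N k p)) / of_nat (N\<^sup>2)"

text \<open>
  All symbols \<open>m\<close> used below satisfy \<open>m (- k) = cnj (m k)\<close>, with \<open>- k\<close> reduced modulo \<open>N\<close> to
  the wavenumber set. So the sum is real, and taking the real part only
  changes its type.
\<close>

definition fourier_multiplier ::
  "nat \<Rightarrow> (index \<Rightarrow> complex) \<Rightarrow> (index \<Rightarrow> real) \<Rightarrow> (index \<Rightarrow> real)" where
  "fourier_multiplier N m f =
     (\<lambda>p. Re (\<Sum>k\<in>wavenumbers N. m k * dft N f k * cis (phase N k p)))"

definition frac_laplacian :: "nat \<Rightarrow> real \<Rightarrow> (index \<Rightarrow> real) \<Rightarrow> (index \<Rightarrow> real)" where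
  "frac_laplacian N s =
     fourier_multiplier N
       (\<lambda>k. of_real (((of_int (fst k))\<^sup>2 + (of_int (snd k))\<^sup>2) powr (s / 2)))"


section \<open>Spectral Hodge projection\<close>

text \<open>
  Symbol of the spectral derivative. The Nyquist wavenumber \<open>N / 2\<close> is aliased with \<open>- N / 2\<close>,
  so an odd symbol has to vanish there; this is the usual convention for the spectral
  derivative of real data, and it makes the projection below a real orthogonal projection.
\<close>

definition deriv_wavenumber :: "nat \<Rightarrow> int \<Rightarrow> real" where
  "deriv_wavenumber N k = (if 2 * k = int N then 0 else of_int k)"

definition spectral_dx :: "nat \<Rightarrow> (index \<Rightarrow> real) \<Rightarrow> (index \<Rightarrow> real)" where
  "spectral_dx N = fourier_multiplier N (\<lambda>k. \<i> * of_real (deriv_wavenumber N (fst k)))"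

definition spectral_dy :: "nat \<Rightarrow> (index \<Rightarrow> real) \<Rightarrow> (index \<Rightarrow> real)" where
  "spectral_dy N = fourier_multiplier N (\<lambda>k. \<i> * of_real (deriv_wavenumber N (snd k)))"

text \<open>
  Pseudo-inverse of \<open>spectral_dx \<circ> spectral_dx + spectral_dy \<circ> spectral_dy\<close>: where the symbol of
  that operator vanishes, \<open>x / 0 = 0\<close> gives the symbol \<open>0\<close>.
\<close>

definition spectral_inv_laplacian :: "nat \<Rightarrow> (index \<Rightarrow> real) \<Rightarrow> (index \<Rightarrow> real)" where
  "spectral_inv_laplacian N =
     fourier_multiplier N
       (\<lambda>k. of_real (- 1 / ((deriv_wavenumber N (fst k))\<^sup>2 + (deriv_wavenumber N (snd k))\<^sup>2)))"

definition div_projection :: "nat \<Rightarrow> (index \<Rightarrow> real ^ 3) \<Rightarrow> (index \<Rightarrow> real ^ 3)" where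
  "div_projection N U =
     (let \<phi> = spectral_inv_laplacian N
                (\<lambda>p. spectral_dx N (component U 1) p + spectral_dy N (component U 2) p)
      in (\<lambda>p. vector [U p $ 1 - spectral_dx N \<phi> p, U p $ 2 - spectral_dy N \<phi> p, U p $ 3]))"


section \<open>Triangulation and piecewise linear functions\<close>

text \<open>
  A triangulation of the torus is represented by its lift to the plane. A triangle is the set
  of the indices of its three vertices, an edge a two-element subset of a triangle.
\<close>

definition triangle :: "nat \<Rightarrow> index set \<Rightarrow> (real \<times> real) set" where
  "triangle N T = convex hull (pt N ` T)"

definition periodic_triangulation :: "nat \<Rightarrow> index set set \<Rightarrow> bool" where
  "periodic_triangulation N \<T> \<longleftrightarrow>
     (\<forall>T\<in>\<T>. card T = 3 \<and> \<not> collinear (pt N ` T)) \<and>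
     \<Union>\<T> = UNIV \<and>
     (\<Union>T\<in>\<T>. triangle N T) = UNIV \<and>
     (\<forall>S\<in>\<T>. \<forall>T\<in>\<T>. triangle N S \<inter> triangle N T = triangle N (S \<inter> T)) \<and>
     (\<forall>K. bounded K \<longrightarrow> finite {T \<in> \<T>. triangle N T \<inter> K \<noteq> {}}) \<and>
     (\<forall>T\<in>\<T>. \<forall>a b. (\<lambda>p. (fst p + a * int N, snd p + b * int N)) ` T \<in> \<T>)"

definition pl_space :: "nat \<Rightarrow> index set set \<Rightarrow> (real \<times> real \<Rightarrow> real) set" where
  "pl_space N \<T> =
     {v. continuous_on UNIV v \<and>
         (\<forall>x y. v (x + 2 * pi, y) = v (x, y) \<and> v (x, y + 2 * pi) = v (x, y)) \<and>
         (\<forall>T\<in>\<T>. \<exists>c g. \<forall>x\<in>triangle N T. v x = c + g \<bullet> x)}"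

definition pl_interp :: "nat \<Rightarrow> index set set \<Rightarrow> (index \<Rightarrow> real) \<Rightarrow> (real \<times> real \<Rightarrow> real)" where
  "pl_interp N \<T> f = (THE v. v \<in> pl_space N \<T> \<and> (\<forall>p. v (pt N p) = f p))"


section \<open>Morley recovery and edge penalty\<close>

text \<open>
  The gradient is unspecified where the function is not differentiable; for piecewise linear
  functions that is contained in a null set.
\<close>

definition grad :: "(real \<times> real \<Rightarrow> real) \<Rightarrow> real \<times> real \<Rightarrow> real \<times> real" where
  "grad f x = (THE D. GDERIV f x :> D)"

text \<open>
  The ordering of the endpoints of an edge is arbitrary; none of the
  notions defined from it depends on the choice.
\<close>

definition endpoints :: "index set \<Rightarrow> index \<times> index" where
  "endpoints e = (SOME (p, q). e = {p, q})"

definition edge_start :: "nat \<Rightarrow> index set \<Rightarrow> real \<times> real" where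
  "edge_start N e = pt N (fst (endpoints e))"

definition edge_end :: "nat \<Rightarrow> index set \<Rightarrow> real \<times> real" where
  "edge_end N e = pt N (snd (endpoints e))"

definition edge_length :: "nat \<Rightarrow> index set \<Rightarrow> real" where
  "edge_length N e = dist (edge_start N e) (edge_end N e)"

definition edge_mid :: "nat \<Rightarrow> index set \<Rightarrow> real \<times> real" where
  "edge_mid N e = midpoint (edge_start N e) (edge_end N e)"

definition unit_normal :: "nat \<Rightarrow> index set \<Rightarrow> real \<times> real \<Rightarrow> bool" where
  "unit_normal N e n \<longleftrightarrow> norm n = 1 \<and> n \<bullet> (edge_end N e - edge_start N e) = 0"

definition edge_integral :: "nat \<Rightarrow> index set \<Rightarrow> (real \<times> real \<Rightarrow> real) \<Rightarrow> real" where
  "edge_integral N e F =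
     edge_length N e * integral {0..1} (\<lambda>t. F (linepath (edge_start N e) (edge_end N e) t))"

definition plane_edges :: "index set set \<Rightarrow> index set set" where
  "plane_edges \<T> = {e. card e = 2 \<and> (\<exists>T\<in>\<T>. e \<subseteq> T)}"

text \<open>One representative of each edge of the torus: the edges with midpoint in \<open>[0, 2 \<pi>)\<^sup>2\<close>.\<close>

definition torus_edges :: "nat \<Rightarrow> index set set \<Rightarrow> index set set" where
  "torus_edges N \<T> = {e \<in> plane_edges \<T>. edge_mid N e \<in> {0..<2 * pi} \<times> {0..<2 * pi}}"

definition edge_patch :: "nat \<Rightarrow> index set set \<Rightarrow> index set \<Rightarrow> (real \<times> real) set" where
  "edge_patch N \<T> e = (\<Union>T\<in>{T \<in> \<T>. e \<subseteq> T}. triangle N T)"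

definition avg_grad ::
  "nat \<Rightarrow> index set set \<Rightarrow> (real \<times> real \<Rightarrow> real) \<Rightarrow> index set \<Rightarrow> real \<times> real" where
  "avg_grad N \<T> v e =
     (1 / measure lebesgue (edge_patch N \<T> e)) *\<^sub>R integral (edge_patch N \<T> e) (grad v)"

definition quadratic :: "(real \<times> real \<Rightarrow> real) \<Rightarrow> bool" where
  "quadratic w \<longleftrightarrow>
     (\<exists>a b c d e f. \<forall>x y. w (x, y) = a + b * x + c * y + d * x\<^sup>2 + e * x * y + f * y\<^sup>2)"

text \<open>
  A Morley function is in general discontinuous across edges, so it is given by its local
  polynomial \<open>w T\<close> on each triangle \<open>T\<close>; the value off the triangulation is fixed to \<open>0\<close> so that
  the family is determined.
\<close>

definition morley_space ::
  "nat \<Rightarrow> index set set \<Rightarrow> (index set \<Rightarrow> real \<times> real \<Rightarrow> real) set" where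
  "morley_space N \<T> =
     {w. (\<forall>T\<in>\<T>. quadratic (w T)) \<and>
         (\<forall>T. T \<notin> \<T> \<longrightarrow> w T = (\<lambda>_. 0)) \<and>
         (\<forall>S\<in>\<T>. \<forall>T\<in>\<T>. \<forall>p\<in>S \<inter> T. w S (pt N p) = w T (pt N p)) \<and>
         (\<forall>S\<in>\<T>. \<forall>T\<in>\<T>. \<forall>e n. card e = 2 \<and> e \<subseteq> S \<inter> T \<and> unit_normal N e n \<longrightarrow>
            n \<bullet> grad (w S) (edge_mid N e) = n \<bullet> grad (w T) (edge_mid N e))}"

text \<open>Periodicity of the interpolant of a periodic function follows from uniqueness.\<close>

definition morley_interp ::
  "nat \<Rightarrow> index set set \<Rightarrow> (real \<times> real \<Rightarrow> real) \<Rightarrow> (index set \<Rightarrow> real \<times> real \<Rightarrow> real)" where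
  "morley_interp N \<T> v =
     (THE w. w \<in> morley_space N \<T> \<and>
        (\<forall>T\<in>\<T>. \<forall>p\<in>T. w T (pt N p) = v (pt N p)) \<and>
        (\<forall>T\<in>\<T>. \<forall>e n. card e = 2 \<and> e \<subseteq> T \<and> unit_normal N e n \<longrightarrow>
           n \<bullet> grad (w T) (edge_mid N e) = n \<bullet> avg_grad N \<T> v e))"

definition recovered_grad ::
  "nat \<Rightarrow> index set set \<Rightarrow> (real \<times> real \<Rightarrow> real) \<Rightarrow> index set \<Rightarrow> real \<times> real \<Rightarrow> real \<times> real" where
  "recovered_grad N \<T> v T = grad (morley_interp N \<T> v T)"

definition edge_triangles :: "index set set \<Rightarrow> index set \<Rightarrow> index set \<times> index set" where
  "edge_triangles \<T> e = (SOME (S, T). S \<noteq> T \<and> {S, T} = {K \<in> \<T>. e \<subseteq> K})"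

text \<open>The sign of the jump is arbitrary; it cancels in the penalty form.\<close>

definition jump ::
  "nat \<Rightarrow> index set set \<Rightarrow> (real \<times> real \<Rightarrow> real) \<Rightarrow> index set \<Rightarrow> real \<times> real \<Rightarrow> real \<times> real" where
  "jump N \<T> v e x =
     recovered_grad N \<T> v (fst (edge_triangles \<T> e)) x -
     recovered_grad N \<T> v (snd (edge_triangles \<T> e)) x"

definition penalty_form ::
  "nat \<Rightarrow> index set set \<Rightarrow> (real \<times> real \<Rightarrow> real) \<Rightarrow> (real \<times> real \<Rightarrow> real) \<Rightarrow> real" where
  "penalty_form N \<T> u v =
     (\<Sum>e\<in>torus_edges N \<T>.
        1 / edge_length N e * edge_integral N e (\<lambda>x. jump N \<T> u e x \<bullet> jump N \<T> v e x))"

definition penalty_op :: "nat \<Rightarrow> index set set \<Rightarrow> (index \<Rightarrow> real) \<Rightarrow> (index \<Rightarrow> real)" where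
  "penalty_op N \<T> u =
     (THE g. g \<in> grid_functions N \<and>
        (\<forall>v\<in>grid_functions N.
           grid_inner N g v = penalty_form N \<T> (pl_interp N \<T> u) (pl_interp N \<T> v)))"

end

theory Submission
  imports Defs
begin

text \<open>
  Pairing the scheme with the new iterate \<open>U\<close> (the field \<open>Bstar\<close>, with \<open>V\<close> the old field) reduces
  everything to four facts. By summation by parts the discrete curl \<open>C\<close> is symmetric, so the Hall term
  contributes \<open>(C U \<times> V, C U) = 0\<close>. By Parseval the fractional Laplacian contributes the squared norm of
  its square root, and the Hodge projection removes in each Fourier mode the component along a real
  vector, hence does not increase the norm. The penalty operator contributes the penalty form because
  that form is linear in its second argument and so has a Riesz representative. The linearity rests
  on the unique solvability of piecewise linear interpolation and of the Morley element.
\<close>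

section \<open>Discrete Fourier analysis\<close>

text \<open>The objects \<open>pl_interp\<close>, \<open>morley_interp\<close> and
  \<open>penalty_op\<close> are definite descriptions, so nothing about them is available before
  existence and uniqueness are proved; most of the length goes into this. The Morley problem splits
  into independent problems on single triangles, since neighbours receive the same vertex values and
  the same averaged gradient on a common edge. The gradient of a piecewise linear function is
  unspecified where the function is not differentiable, so its linearity is used only under the
  integral, off a null set. On the Fourier side the delicate point is the wavenumber N/2, which is
  its own negative modulo N: evenness of N makes the wavenumbers a full residue system, and the
  derivative symbol vanishes at N/2. The increment term in the energy comes from the identity 2 (a -
  b, a) = |a|^2 + |a - b|^2 - |b|^2, applied to the time difference paired with the implicit
  iterate.\<close>

definition grid_character :: "nat \<Rightarrow> int \<Rightarrow> complex" where
  "grid_character N j = cis (spacing N * of_int j)"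

lemma char_add: "grid_character N (i + j) = grid_character N i * grid_character N j"
  by (simp add: grid_character_def cis_mult algebra_simps)

lemma cnj_character: "cnj (grid_character N j) = grid_character N (- j)"
  by (simp add: grid_character_def cis_cnj)

lemma char_eq_1_iff:
  assumes "N > 0"
  shows "grid_character N j = 1 \<longleftrightarrow> int N dvd j"
proof -
  have "grid_character N j = 1 \<longleftrightarrow> cos (spacing N * of_int j) = 1"
    by (auto simp: grid_character_def complex_eq_iff intro: cos_one_sin_zero)
  also have "\<dots> \<longleftrightarrow> (\<exists>n::int. spacing N * of_int j = of_int n * (2 * pi))"
    by (simp add: cos_one_2pi_int mult.commute mult.left_commute)
  also have "\<dots> \<longleftrightarrow> (\<exists>n::int. real_of_int j = of_int (int N * n))"
    using assms by (simp add: spacing_def field_simps)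
  also have "\<dots> \<longleftrightarrow> int N dvd j"
    by (simp only: of_int_eq_iff dvd_def)
  finally show ?thesis .
qed

text \<open>The terms are powers of an N-th root of unity. If the root is 1, every term is 1;
  otherwise the geometric sum vanishes.\<close>

lemma sum_char:
  assumes "N > 0"
  shows "(\<Sum>x\<in>{0..<int N}. grid_character N (j * x)) = (if int N dvd j then of_nat N else 0)"
proof -
  have pow: "grid_character N (j * int n) = grid_character N j ^ n" for n
    by (induction n) (simp_all add: char_add distrib_left, simp add: grid_character_def)
  have "(\<Sum>x\<in>{0..<int N}. grid_character N (j * x)) = (\<Sum>n<N. grid_character N j ^ n)"
    by (rule sum.reindex_bij_witness[where i = int and j = nat]) (auto simp flip: pow)
  also have "\<dots> = (if int N dvd j then of_nat N else 0)"
  proof (cases "int N dvd j")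
    case True
    then show ?thesis using char_eq_1_iff[OF assms, of j] by simp
  next
    case False
    then have "grid_character N j \<noteq> 1" using char_eq_1_iff[OF assms] by simp
    moreover have "grid_character N j ^ N = 1"
      using char_eq_1_iff[OF assms, of "j * int N"] by (simp add: pow)
    ultimately show ?thesis using False by (simp add: geometric_sum)
  qed
  finally show ?thesis .
qed

text \<open>At grid points the phase is an integer multiple of the spacing, so every orthogonality
  relation below becomes a question of divisibility by N.\<close>

lemma cis_phase: "cis (phase N k p) = grid_character N (fst k * fst p + snd k * snd p)"
  by (simp add: grid_character_def phase_def pt_def algebra_simps)

lemma cis_phase_neg: "cis (- phase N k p) = cnj (cis (phase N k p))"
  by (simp add: cis_cnj)

lemma sum_cell_char:
  assumes "N > 0"
  shows "(\<Sum>p\<in>cell N. grid_character N (a * fst p + b * snd p))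
           = (if int N dvd a \<and> int N dvd b then of_nat (N\<^sup>2) else 0)"
proof -
  have "(\<Sum>p\<in>cell N. grid_character N (a * fst p + b * snd p))
      = (\<Sum>x\<in>{0..<int N}. grid_character N (a * x)) * (\<Sum>y\<in>{0..<int N}. grid_character N (b * y))"
    by (simp add: cell_def sum_product sum.cartesian_product char_add case_prod_unfold)
  then show ?thesis
    by (simp add: sum_char[OF assms] power2_eq_square)
qed

text \<open>For even N each factor of the wavenumber set consists of exactly N consecutive integers,
  a shifted copy of 0, ..., N - 1. The shift contributes a factor that equals 1 whenever the
  remaining sum is nonzero.\<close>

lemma sum_wavenumbers_char:
  assumes "N > 0" "even N"
  shows "(\<Sum>k\<in>wavenumbers N. grid_character N (fst k * a + snd k * b))
           = (if int N dvd a \<and> int N dvd b then of_nat (N\<^sup>2) else 0)"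
proof -
  define M where "M = int N div 2"
  have M: "int N = 2 * M" using assms(2) by (simp add: M_def)
  have one: "(\<Sum>k\<in>{- M + 1..M}. grid_character N (k * c)) = (if int N dvd c then of_nat N else 0)" for c
  proof -
    have "(\<Sum>k\<in>{- M + 1..M}. grid_character N (k * c)) = (\<Sum>x\<in>{0..<int N}. grid_character N ((x + (1 - M)) * c))"
      by (rule sum.reindex_bij_witness[where i = "\<lambda>x. x + (1 - M)" and j = "\<lambda>k. k - (1 - M)"])
        (auto simp: M)
    also have "\<dots> = grid_character N ((1 - M) * c) * (\<Sum>x\<in>{0..<int N}. grid_character N (c * x))"
      by (simp add: sum_distrib_left char_add[symmetric] algebra_simps)
    also have "\<dots> = (if int N dvd c then of_nat N else 0)"
      using char_eq_1_iff[OF assms(1), of "(1 - M) * c"] by (auto simp: sum_char[OF assms(1)])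
    finally show ?thesis .
  qed
  have "(\<Sum>k\<in>wavenumbers N. grid_character N (fst k * a + snd k * b))
      = (\<Sum>x\<in>{- M + 1..M}. grid_character N (x * a)) * (\<Sum>y\<in>{- M + 1..M}. grid_character N (y * b))"
    by (simp add: wavenumbers_def M_def sum_product sum.cartesian_product char_add case_prod_unfold)
  then show ?thesis
    unfolding one by (simp add: power2_eq_square)
qed

lemma dvd_diff_eq:
  fixes a b m n :: int
  assumes "n dvd a - b" "\<bar>a - b\<bar> < n"
  shows "a = b"
  using assms zdvd_not_zless[of "\<bar>a - b\<bar>" n] by auto

text \<open>Orthogonality only detects congruence modulo N; within one period box congruence is
  equality, which is what collapses the double sums to a diagonal.\<close>

lemma cell_cong_eq:
  assumes "p \<in> cell N" "q \<in> cell N" "int N dvd fst p - fst q" "int N dvd snd p - snd q"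
  shows "p = q"
  using assms dvd_diff_eq[of "int N" "fst p" "fst q"] dvd_diff_eq[of "int N" "snd p" "snd q"]
  by (auto simp: cell_def prod_eq_iff)

lemma wavenumbers_cong_eq:
  assumes "k \<in> wavenumbers N" "l \<in> wavenumbers N"
    "int N dvd fst k - fst l" "int N dvd snd k - snd l"
  shows "k = l"
proof -
  have "\<bar>x - y\<bar> < int N"
    if "x \<in> {- (int N div 2) + 1..int N div 2}" "y \<in> {- (int N div 2) + 1..int N div 2}" for x y
    using that by auto
  then show ?thesis
    using assms dvd_diff_eq[of "int N" "fst k" "fst l"] dvd_diff_eq[of "int N" "snd k" "snd l"]
    by (auto simp: wavenumbers_def prod_eq_iff)
qed

lemma finite_cell: "finite (cell N)"
  by (simp add: cell_def)

lemma finite_wavenumbers: "finite (wavenumbers N)"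
  by (simp add: wavenumbers_def)

text \<open>Expanding both transforms and summing over wavenumbers innermost leaves only the
  diagonal \<open>q = p\<close>. The transforms carry the factor 1/N^2 each and orthogonality
  returns N^2, which accounts for the constant.\<close>

theorem dft_parseval:
  assumes "N > 0" "even N"
  shows "of_real (\<Sum>p\<in>cell N. f p * g p)
           = of_nat (N\<^sup>2) * (\<Sum>k\<in>wavenumbers N. dft N f k * cnj (dft N g k))"
proof -
  let ?n = "of_nat (N\<^sup>2) :: complex"
  have n: "?n \<noteq> 0" using assms by simp
  have "dft N f k * cnj (dft N g k)
      = (\<Sum>p\<in>cell N. \<Sum>q\<in>cell N. of_real (f p * g q) / ?n\<^sup>2
           * grid_character N (fst k * (fst q - fst p) + snd k * (snd q - snd p)))" for k
  proof -
    have "dft N f k * cnj (dft N g k)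
        = (\<Sum>p\<in>cell N. \<Sum>q\<in>cell N.
            of_real (f p) / ?n * cnj (cis (phase N k p)) * (of_real (g q) / ?n * cis (phase N k q)))"
      by (simp add: dft_def sum_product cis_phase_neg sum_divide_distrib)
    also have "\<dots> = (\<Sum>p\<in>cell N. \<Sum>q\<in>cell N. of_real (f p * g q) / ?n\<^sup>2
           * grid_character N (fst k * (fst q - fst p) + snd k * (snd q - snd p)))"
    proof (intro sum.cong refl)
      fix p q
      have "cnj (cis (phase N k p)) * cis (phase N k q)
          = grid_character N (fst k * (fst q - fst p) + snd k * (snd q - snd p))"
        by (simp add: cis_phase cnj_character char_add[symmetric] algebra_simps)
      then show "of_real (f p) / ?n * cnj (cis (phase N k p)) * (of_real (g q) / ?n * cis (phase N k q))
          = of_real (f p * g q) / ?n\<^sup>2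
           * grid_character N (fst k * (fst q - fst p) + snd k * (snd q - snd p))"
        by (simp add: power2_eq_square)
    qed
    finally show ?thesis .
  qed
  then have "(\<Sum>k\<in>wavenumbers N. dft N f k * cnj (dft N g k))
      = (\<Sum>k\<in>wavenumbers N. \<Sum>p\<in>cell N. \<Sum>q\<in>cell N. of_real (f p * g q) / ?n\<^sup>2
           * grid_character N (fst k * (fst q - fst p) + snd k * (snd q - snd p)))"
    by simp
  also have "\<dots> = (\<Sum>p\<in>cell N. \<Sum>q\<in>cell N. of_real (f p * g q) / ?n\<^sup>2
           * (\<Sum>k\<in>wavenumbers N. grid_character N (fst k * (fst q - fst p) + snd k * (snd q - snd p))))"
    by (subst sum.swap, rule sum.cong[OF refl], subst sum.swap)
      (simp add: sum_distrib_left)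
  also have "\<dots> = (\<Sum>p\<in>cell N. \<Sum>q\<in>cell N. if q = p then of_real (f p * g q) / ?n else 0)"
    by (intro sum.cong refl)
      (use n cell_cong_eq in \<open>auto simp: sum_wavenumbers_char[OF assms] power2_eq_square\<close>)
  also have "\<dots> = of_real (\<Sum>p\<in>cell N. f p * g p) / ?n"
    by (simp add: finite_cell sum_divide_distrib)
  finally show ?thesis using n by simp
qed

lemma grid_inner_eq_dft:
  assumes "N > 0" "even N"
  shows "grid_inner N f g
           = (spacing N)\<^sup>2 * real (N\<^sup>2) * (\<Sum>k\<in>wavenumbers N. Re (dft N f k * cnj (dft N g k)))"
  using arg_cong[OF dft_parseval[OF assms, of f g], of Re]
  by (simp add: grid_inner_def del: of_nat_power flip: of_nat_power)

text \<open>The aliasing convention identifies the wavenumbers \<open>N / 2\<close> and \<open>- N / 2\<close>.\<close>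

definition reflect :: "nat \<Rightarrow> int \<Rightarrow> int" where
  "reflect N j = (if 2 * j = int N then j else - j)"

definition reflect2 :: "nat \<Rightarrow> index \<Rightarrow> index" where
  "reflect2 N k = (reflect N (fst k), reflect N (snd k))"

text \<open>Conjugate symmetry of the symbol, with negation taken modulo aliasing: the condition
  under which the multiplier maps real data to real data.\<close>

definition hermitian :: "nat \<Rightarrow> (index \<Rightarrow> complex) \<Rightarrow> bool" where
  "hermitian N m \<longleftrightarrow> (\<forall>k\<in>wavenumbers N. m (reflect2 N k) = cnj (m k))"

lemma reflect2_involution:
  assumes "even N" "k \<in> wavenumbers N"
  shows "reflect2 N (reflect2 N k) = k"
  using assms by (auto simp: reflect2_def reflect_def wavenumbers_def elim!: evenE)

lemma reflect2_wavenumbers: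
  assumes "even N" "k \<in> wavenumbers N"
  shows "reflect2 N k \<in> wavenumbers N"
  using assms by (auto simp: reflect2_def reflect_def wavenumbers_def elim!: evenE)

lemma cis_phase_reflect2:
  assumes "N > 0"
  shows "cis (phase N (reflect2 N k) p) = cnj (cis (phase N k p))"
proof -
  have "grid_character N (reflect N j * x) = grid_character N (- (j * x))" for j x
  proof -
    \<comment> \<open>The argument is 0, or \<open>N * x\<close> at the aliased wavenumber; both are
      divisible by N.\<close>
    have "grid_character N (reflect N j * x + j * x) = 1"
      unfolding char_eq_1_iff[OF assms] reflect_def by (auto simp flip: distrib_right)
    moreover have "grid_character N (j * x) * grid_character N (- (j * x)) = 1"
      by (simp add: char_eq_1_iff[OF assms] flip: char_add)
    ultimately show ?thesis
      by (simp only: char_add) algebra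
  qed
  then show ?thesis by (simp add: cis_phase reflect2_def char_add cnj_character)
qed

lemma dft_reflect2:
  assumes "N > 0"
  shows "dft N f (reflect2 N k) = cnj (dft N f k)"
  by (simp add: dft_def cis_phase_reflect2[OF assms] cis_phase_neg)

text \<open>Reindexing by the involution \<open>reflect2\<close> turns the sum into its own
  conjugate. The \<open>Re\<close> in the definition therefore discards nothing, and the multiplier
  can be transformed again as a complex sum.\<close>

lemma fourier_multiplier_complex:
  assumes "N > 0" "even N" "hermitian N m"
  shows "of_real (fourier_multiplier N m f p)
           = (\<Sum>k\<in>wavenumbers N. m k * dft N f k * cis (phase N k p))"
proof -
  let ?S = "\<Sum>k\<in>wavenumbers N. m k * dft N f k * cis (phase N k p)"
  have m: "m (reflect2 N k) = cnj (m k)" if "k \<in> wavenumbers N" for k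
    using assms(3) that unfolding hermitian_def by blast
  have "?S = (\<Sum>k\<in>wavenumbers N. cnj (m k * dft N f k * cis (phase N k p)))"
    by (rule sum.reindex_bij_witness[where i = "reflect2 N" and j = "reflect2 N"])
      (use assms(1,2) in \<open>simp_all add: reflect2_involution reflect2_wavenumbers m
          cis_phase_reflect2 dft_reflect2\<close>)
  then have "?S = cnj ?S" by simp
  then have "Im ?S = 0" by (metis cnj.simps(2) equal_neg_zero)
  then show ?thesis by (simp add: fourier_multiplier_def complex_eq_iff)
qed

text \<open>Multipliers are diagonal in the Fourier basis: summing over the cell isolates the single
  wavenumber \<open>l\<close>.\<close>

lemma dft_fourier_multiplier:
  assumes "N > 0" "even N" "hermitian N m" "l \<in> wavenumbers N"
  shows "dft N (fourier_multiplier N m f) l = m l * dft N f l"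
proof -
  let ?n = "of_nat (N\<^sup>2) :: complex"
  have n: "?n \<noteq> 0" using assms by simp
  have "dft N (fourier_multiplier N m f) l
      = (\<Sum>p\<in>cell N. \<Sum>k\<in>wavenumbers N. m k * dft N f k / ?n
           * grid_character N ((fst k - fst l) * fst p + (snd k - snd l) * snd p))"
    by (simp add: dft_def[of N _ l] fourier_multiplier_complex[OF assms(1-3)] sum_divide_distrib
        sum_distrib_right cis_phase_neg cis_phase cnj_character mult.assoc char_add[symmetric])
      (simp add: algebra_simps)
  also have "\<dots> = (\<Sum>k\<in>wavenumbers N. m k * dft N f k / ?n
           * (\<Sum>p\<in>cell N. grid_character N ((fst k - fst l) * fst p + (snd k - snd l) * snd p)))"
    by (subst sum.swap) (simp add: sum_distrib_left)
  also have "\<dots> = (\<Sum>k\<in>wavenumbers N. if k = l then m k * dft N f k else 0)"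
    by (intro sum.cong refl)
      (use n wavenumbers_cong_eq assms(4) in \<open>auto simp: sum_cell_char[OF assms(1)]\<close>)
  also have "\<dots> = m l * dft N f l"
    using assms(4) by (simp add: finite_wavenumbers)
  finally show ?thesis .
qed

lemma grid_inner_frac_laplacian:
  assumes "N > 0" "even N"
  shows "grid_inner N (frac_laplacian N s f) f
           = grid_inner N (frac_laplacian N (s / 2) f) (frac_laplacian N (s / 2) f)"
proof -
  define m :: "real \<Rightarrow> index \<Rightarrow> complex" where
    "m s k = of_real (((of_int (fst k))\<^sup>2 + (of_int (snd k))\<^sup>2) powr (s / 2))" for s k
  have herm: "hermitian N (m s)" for s
    by (auto simp: hermitian_def m_def reflect2_def reflect_def)
  have fl: "frac_laplacian N s = fourier_multiplier N (m s)" for s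
    by (simp add: frac_laplacian_def m_def[abs_def])
  \<comment> \<open>The exponents \<open>s / 4\<close> add up to \<open>s / 2\<close>. The zero mode
    is included, because \<open>0 powr a = 0\<close> makes both sides vanish.\<close>
  have "m s k = m (s / 2) k * cnj (m (s / 2) k)" for k
    by (simp add: m_def flip: of_real_mult powr_add)
  then show ?thesis
    by (auto simp: grid_inner_eq_dft[OF assms] fl dft_fourier_multiplier[OF assms herm]
        mult.assoc mult.left_commute intro!: sum.cong)
qed

section \<open>Contraction property of the Hodge projection\<close>

lemma dft_diff: "dft N (\<lambda>p. f p - g p) k = dft N f k - dft N g k"
  by (simp add: dft_def sum_subtractf diff_divide_distrib algebra_simps)

lemma dft_add: "dft N (\<lambda>p. f p + g p) k = dft N f k + dft N g k"
  by (simp add: dft_def sum.distrib add_divide_distrib algebra_simps)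

text \<open>Removing the orthogonal projection of \<open>(a, b)\<close> onto the direction \<open>(c, d)\<close>.\<close>

lemma projection_norm_le:
  fixes a b s :: complex and c d :: real
  defines "s \<equiv> (c * a + d * b) / complex_of_real (c\<^sup>2 + d\<^sup>2)"
  shows "(cmod (a - c * s))\<^sup>2 + (cmod (b - d * s))\<^sup>2 \<le> (cmod a)\<^sup>2 + (cmod b)\<^sup>2"
proof (cases "c\<^sup>2 + d\<^sup>2 = 0")
  case True
  then show ?thesis by (simp add: sum_power2_eq_zero_iff)
next
  case False
  let ?n = "c\<^sup>2 + d\<^sup>2"
  have n: "?n > 0" using False by (simp add: sum_power2_gt_zero_iff)
  have s: "complex_of_real ?n * s = c * a + d * b"
    using False unfolding s_def by (simp flip: of_real_power of_real_add)
  have re: "?n * Re s = c * Re a + d * Re b" and im: "?n * Im s = c * Im a + d * Im b"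
    using arg_cong[OF s, of Re] arg_cong[OF s, of Im] by simp_all
  \<comment> \<open>Pythagoras in the plane. The direction \<open>(c, d)\<close> is real, so it can
    be applied to real and imaginary parts separately.\<close>
  have key: "(x - c * z)\<^sup>2 + (y - d * z)\<^sup>2 = x\<^sup>2 + y\<^sup>2 - ?n * z\<^sup>2" if "?n * z = c * x + d * y" for x y z
    using that by algebra
  have "(cmod (a - c * s))\<^sup>2 + (cmod (b - d * s))\<^sup>2
      = ((Re a - c * Re s)\<^sup>2 + (Re b - d * Re s)\<^sup>2) + ((Im a - c * Im s)\<^sup>2 + (Im b - d * Im s)\<^sup>2)"
    by (simp add: cmod_power2)
  also have "\<dots> \<le> ((Re a)\<^sup>2 + (Re b)\<^sup>2) + ((Im a)\<^sup>2 + (Im b)\<^sup>2)"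
    unfolding key[OF re] key[OF im]
    using mult_nonneg_nonneg[OF less_imp_le[OF n] zero_le_power2[of "Re s"]]
      mult_nonneg_nonneg[OF less_imp_le[OF n] zero_le_power2[of "Im s"]] by linarith
  also have "\<dots> = (cmod a)\<^sup>2 + (cmod b)\<^sup>2"
    by (simp add: cmod_power2)
  finally show ?thesis .
qed

lemma grid_inner_vec3:
  "grid_inner N U V = (\<Sum>i\<in>UNIV. grid_inner N (component U i) (component V i))"
  by (simp add: grid_inner_def component_def inner_vec_def sum.swap[of _ _ UNIV] flip: sum_distrib_left)

text \<open>In each mode the symbols of the two derivatives and of the inverse Laplacian compose to
  the orthogonal projection onto the real direction \<open>(d1 k, d2 k)\<close>; subtracting it
  cannot increase the modulus. Parseval sums this over all modes, and the third component is merely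
  copied.\<close>

lemma grid_inner_div_projection_le:
  assumes "N > 0" "even N"
  shows "grid_inner N (div_projection N U) (div_projection N U) \<le> grid_inner N U U"
proof -
  define d1 d2 where "d1 k = deriv_wavenumber N (fst k)" and "d2 k = deriv_wavenumber N (snd k)" for k :: index
  define \<phi> where "\<phi> = spectral_inv_laplacian N
                (\<lambda>p. spectral_dx N (component U 1) p + spectral_dy N (component U 2) p)"
  define a b where "a = dft N (component U 1)" and "b = dft N (component U 2)"
  define V where "V = div_projection N U"
  have V: "V = (\<lambda>p. vector [U p $ 1 - spectral_dx N \<phi> p, U p $ 2 - spectral_dy N \<phi> p, U p $ 3])"
    by (simp add: V_def div_projection_def \<phi>_def Let_def)
  \<comment> \<open>Oddness holds at N/2 only because the symbol is 0 there. The bound on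
    \<open>j\<close> excludes -N/2, whose reflection N/2 has symbol 0 although -N/2 itself does
    not.\<close>
  have "deriv_wavenumber N (reflect N j) = - deriv_wavenumber N j"
    if "j > - (int N div 2)" for j
    using that assms(2) by (auto simp: deriv_wavenumber_def reflect_def elim!: evenE)
  then have dr: "deriv_wavenumber N (reflect N (fst k)) = - deriv_wavenumber N (fst k)"
      "deriv_wavenumber N (reflect N (snd k)) = - deriv_wavenumber N (snd k)"
    if "k \<in> wavenumbers N" for k
    using that by (auto simp: wavenumbers_def)
  have h1: "hermitian N (\<lambda>k. \<i> * of_real (deriv_wavenumber N (fst k)))"
    and h2: "hermitian N (\<lambda>k. \<i> * of_real (deriv_wavenumber N (snd k)))"
    and h3: "hermitian N (\<lambda>k. of_real (- 1 / ((deriv_wavenumber N (fst k))\<^sup>2 + (deriv_wavenumber N (snd k))\<^sup>2)))"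
    by (simp_all add: hermitian_def reflect2_def dr)
  note dm = dft_fourier_multiplier[OF assms]
  have c1: "component V 1 = (\<lambda>p. component U 1 p - spectral_dx N \<phi> p)"
    and c2: "component V 2 = (\<lambda>p. component U 2 p - spectral_dy N \<phi> p)"
    and c3: "component V 3 = component U 3"
    by (simp_all add: V component_def fun_eq_iff)
  have "(cmod (dft N (component V 1) k))\<^sup>2 + (cmod (dft N (component V 2) k))\<^sup>2
      \<le> (cmod (a k))\<^sup>2 + (cmod (b k))\<^sup>2" if k: "k \<in> wavenumbers N" for k
  proof -
    \<comment> \<open>Where both derivative symbols vanish, division by zero makes both
      \<open>s\<close> and the symbol of the inverse Laplacian 0, so the formula for
      \<open>phi\<close> needs no case distinction.\<close>
    define s where "s = (d1 k * a k + d2 k * b k) / ((d1 k)\<^sup>2 + (d2 k)\<^sup>2)"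
    have "dft N \<phi> k = of_real (- 1 / ((d1 k)\<^sup>2 + (d2 k)\<^sup>2)) * (\<i> * d1 k * a k + \<i> * d2 k * b k)"
      unfolding \<phi>_def spectral_inv_laplacian_def dm[OF h3 k]
      by (simp add: dft_add spectral_dx_def spectral_dy_def dm[OF h1 k] dm[OF h2 k]
          a_def b_def d1_def d2_def)
    then have phi: "dft N \<phi> k = - \<i> * s"
      by (simp add: s_def add_divide_distrib algebra_simps)
    have "dft N (component V 1) k = a k - d1 k * s" "dft N (component V 2) k = b k - d2 k * s"
      by (simp_all add: c1 c2 dft_diff spectral_dx_def spectral_dy_def dm[OF h1 k] dm[OF h2 k] phi
          a_def b_def d1_def d2_def algebra_simps)
    then show ?thesis using projection_norm_le[of "a k" "d1 k" "d2 k" "b k"] by (simp add: s_def)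
  qed
  then have "(\<Sum>k\<in>wavenumbers N. (cmod (dft N (component V 1) k))\<^sup>2 + (cmod (dft N (component V 2) k))\<^sup>2)
      \<le> (\<Sum>k\<in>wavenumbers N. (cmod (a k))\<^sup>2 + (cmod (b k))\<^sup>2)"
    by (rule sum_mono)
  then have "grid_inner N (component V 1) (component V 1) + grid_inner N (component V 2) (component V 2)
      \<le> grid_inner N (component U 1) (component U 1) + grid_inner N (component U 2) (component U 2)"
    unfolding grid_inner_eq_dft[OF assms] distrib_left[symmetric] sum.distrib[symmetric]
    by (intro mult_left_mono) (simp_all add: complex_mult_cnj cmod_power2 a_def b_def)
  then show ?thesis
    by (simp add: grid_inner_vec3 sum_3 c3 V_def[symmetric])
qed

section \<open>Barycentric coordinates and piecewise linear interpolation\<close>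

text \<open>The map sending \<open>x\<close> to \<open>c p + g p \<bullet> x\<close> is the
  barycentric coordinate of the vertex \<open>p\<close>, so \<open>g p\<close> is its constant
  gradient. Keeping \<open>c\<close> and \<open>g\<close> as parameters gives access to these
  gradients, which serve below as edge normals.\<close>

locale barycentric =
  fixes N :: nat and T :: "index set" and c :: "index \<Rightarrow> real" and g :: "index \<Rightarrow> real \<times> real"
  assumes card_T: "card T = 3"
    and vertex: "p \<in> T \<Longrightarrow> q \<in> T \<Longrightarrow> c p + g p \<bullet> pt N q = of_bool (p = q)"
    and sum_c: "sum c T = 1" and sum_g: "sum g T = 0"
    and reproduces: "(\<Sum>p\<in>T. (c p + g p \<bullet> x) *\<^sub>R pt N p) = x"
begin

definition lam :: "index \<Rightarrow> real \<times> real \<Rightarrow> real" where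
  "lam p x = c p + g p \<bullet> x"

lemma finite_T: "finite T"
  using card_T by (metis card.infinite zero_neq_numeral)

lemma lam_vertex: "p \<in> T \<Longrightarrow> q \<in> T \<Longrightarrow> lam p (pt N q) = of_bool (p = q)"
  by (simp add: lam_def vertex)

lemma sum_lam: "(\<Sum>p\<in>T. lam p x) = 1"
  by (simp add: lam_def sum.distrib sum_c sum_g flip: inner_sum_left)

lemma sum_lam_pt: "(\<Sum>p\<in>T. lam p x *\<^sub>R pt N p) = x"
  by (simp add: lam_def reproduces)

lemma sum_lam_affine: "\<exists>a b. \<forall>x. (\<Sum>p\<in>T. f p * lam p x) = a + b \<bullet> x"
  by (intro exI[of _ "\<Sum>p\<in>T. f p * c p"] exI[of _ "\<Sum>p\<in>T. f p *\<^sub>R g p"])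
    (simp add: lam_def algebra_simps sum.distrib inner_sum_left)

end

lemma collinear_det:
  fixes A B C :: "real \<times> real"
  assumes "(fst B - fst A) * (snd C - snd A) - (snd B - snd A) * (fst C - fst A) = 0"
  shows "collinear {A, B, C}"
proof (cases "B = A")
  case True
  then show ?thesis by simp
next
  case False
  define x y where "x = fst B - fst A" and "y = snd B - snd A"
  define u v where "u = fst C - fst A" and "v = snd C - snd A"
  \<comment> \<open>The coefficient of the orthogonal projection of \<open>C - A\<close> onto
    \<open>B - A\<close>; a zero determinant makes this projection equal to
    \<open>C - A\<close>.\<close>
  define t where "t = (x * u + y * v) / (x\<^sup>2 + y\<^sup>2)"
  have n: "x\<^sup>2 + y\<^sup>2 \<noteq> 0" using False by (auto simp: x_def y_def sum_power2_eq_zero_iff prod_eq_iff)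
  have d: "x * v = y * u" using assms by (simp add: x_def y_def u_def v_def)
  have t: "t * (x\<^sup>2 + y\<^sup>2) = x * u + y * v" using n by (simp add: t_def)
  have "(t * x - u) * (x\<^sup>2 + y\<^sup>2) = 0" "(t * y - v) * (x\<^sup>2 + y\<^sup>2) = 0"
    using t d by algebra+
  then have "u = t * x" "v = t * y" using n by auto
  then have "C - A = t *\<^sub>R (B - A)"
    by (simp add: prod_eq_iff x_def y_def u_def v_def)
  then have "collinear {0, B - A, C - A}" unfolding collinear_lemma by blast
  then show ?thesis
    using collinear_3[of B A C] by (simp add: NO_MATCH_def insert_commute)
qed

lemma barycentric_coordinates_exist:
  assumes "card T = 3" "\<not> collinear (pt N ` T)"
  shows "\<exists>c g. barycentric N T c g"
proof -
  obtain P Q R where T: "T = {P, Q, R}" and ne: "P \<noteq> Q" "P \<noteq> R" "Q \<noteq> R"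
    using assms(1) by (auto simp: card_3_iff)
  obtain px py qx qy rx ry where pq: "pt N P = (px, py)" "pt N Q = (qx, qy)" "pt N R = (rx, ry)"
    by (metis surj_pair)
  \<comment> \<open>Twice the signed area of the triangle. By Cramer's rule the coordinate of a
    vertex is the same determinant with that vertex replaced by \<open>x\<close>, divided by
    \<open>D\<close>; \<open>c'\<close> and \<open>g'\<close> are the constant and linear parts of
    the numerators.\<close>
  define D where "D = (qx - px) * (ry - py) - (qy - py) * (rx - px)"
  have "D \<noteq> 0"
    using collinear_det[of "pt N Q" "pt N P" "pt N R"] assms(2) by (auto simp: D_def pq T)
  define c' where "c' = (\<lambda>p. if p = P then qx * ry - qy * rx else if p = Q then rx * py - ry * px
     else px * qy - py * qx)"
  define g' where "g' = (\<lambda>p. if p = P then (qy - ry, rx - qx) else if p = Q then (ry - py, px - rx)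
     else (py - qy, qx - px))"
  define c g where "c p = c' p / D" and "g p = (1 / D) *\<^sub>R g' p" for p
  have lam: "c p + g p \<bullet> x = (c' p + g' p \<bullet> x) / D" for p x
    by (simp add: c_def g_def add_divide_distrib)
  have "barycentric N T c g"
  proof
    show "card T = 3" by fact
    show "c p + g p \<bullet> pt N q = of_bool (p = q)" if "p \<in> T" "q \<in> T" for p q
    proof -
      have "c' p + g' p \<bullet> pt N q = D * of_bool (p = q)"
        using that ne by (auto simp: T pq c'_def g'_def D_def algebra_simps)
      then show ?thesis using \<open>D \<noteq> 0\<close> by (simp add: lam)
    qed
    have "sum c' T = D"
      using ne by (simp add: T c'_def D_def algebra_simps)
    then show "sum c T = 1"
      using \<open>D \<noteq> 0\<close> by (simp add: c_def flip: sum_divide_distrib)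
    have "sum g' T = 0"
      using ne by (simp add: T g'_def zero_prod_def)
    then show "sum g T = 0"
      by (simp add: g_def flip: scaleR_sum_right)
    show "(\<Sum>p\<in>T. (c p + g p \<bullet> x) *\<^sub>R pt N p) = x" for x
    proof -
      have "(\<Sum>p\<in>T. (c' p + g' p \<bullet> x) *\<^sub>R pt N p) = D *\<^sub>R x"
        using ne by (cases x) (simp add: T pq c'_def g'_def, simp add: D_def algebra_simps)
      moreover have "(\<Sum>p\<in>T. (c p + g p \<bullet> x) *\<^sub>R pt N p)
          = (1 / D) *\<^sub>R (\<Sum>p\<in>T. (c' p + g' p \<bullet> x) *\<^sub>R pt N p)"
        by (simp add: lam scaleR_sum_right)
      ultimately show ?thesis
        using \<open>D \<noteq> 0\<close> by simp
    qed
  qed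
  then show ?thesis by blast
qed

text \<open>The set where two affine functions agree is convex, hence contains the hull of the
  vertices. \<open>T\<close> may be any index set, so common faces \<open>S \<inter> T\<close> of
  two triangles are covered as well.\<close>

lemma affine_eq_on_triangle:
  assumes "\<And>p. p \<in> T \<Longrightarrow> a + b \<bullet> pt N p = a' + b' \<bullet> pt N p" "x \<in> triangle N T"
  shows "a + b \<bullet> x = a' + b' \<bullet> x"
proof -
  have "{x. a + b \<bullet> x = a' + b' \<bullet> x} = {x. (b - b') \<bullet> x = a' - a}"
    by (auto simp: algebra_simps)
  then have "convex {x. a + b \<bullet> x = a' + b' \<bullet> x}"
    by (simp add: convex_hyperplane)
  then have "convex hull (pt N ` T) \<subseteq> {x. a + b \<bullet> x = a' + b' \<bullet> x}"
    using assms(1) by (intro hull_minimal) auto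
  then show ?thesis using assms(2) by (auto simp: triangle_def)
qed

text \<open>The affine clause of \<open>pl_space\<close> by itself. Uniqueness is proved at this
  level so that it can be applied to translates while periodicity is still to be shown.\<close>

definition piecewise_affine :: "nat \<Rightarrow> index set set \<Rightarrow> (real \<times> real \<Rightarrow> real) \<Rightarrow> bool" where
  "piecewise_affine N \<T> v \<longleftrightarrow> (\<forall>T\<in>\<T>. \<exists>c g. \<forall>x\<in>triangle N T. v x = c + g \<bullet> x)"

lemma piecewise_affineE:
  assumes "piecewise_affine N \<T> v" "T \<in> \<T>"
  obtains c g where "\<forall>x\<in>triangle N T. v x = c + g \<bullet> x"
proof -
  have "\<exists>c g. \<forall>x\<in>triangle N T. v x = c + g \<bullet> x"
    using assms by (simp add: piecewise_affine_def)
  then show thesis by (elim exE) (rule that)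
qed

lemma vertex_in_triangle: "p \<in> T \<Longrightarrow> pt N p \<in> triangle N T"
  by (simp add: triangle_def hull_inc)

lemma compact_triangle: "finite T \<Longrightarrow> compact (triangle N T)"
  by (simp add: triangle_def finite_imp_compact_convex_hull)

lemma pt_shift:
  assumes "N > 0"
  shows "pt N (fst p + a * int N, snd p + b * int N) = (2 * pi * of_int a, 2 * pi * of_int b) + pt N p"
  using assms by (simp add: pt_def spacing_def field_simps)

lemma triangle_shift:
  assumes "N > 0"
  shows "triangle N ((\<lambda>p. (fst p + a * int N, snd p + b * int N)) ` T)
           = (+) (2 * pi * of_int a, 2 * pi * of_int b) ` triangle N T"
  by (simp add: triangle_def image_image pt_shift[OF assms] flip: convex_hull_translation)

section \<open>Piecewise linear interpolation on the periodic mesh\<close>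

locale mesh =
  fixes N :: nat and \<T> :: "index set set"
  assumes N_pos: "N > 0" and triangulation: "periodic_triangulation N \<T>"
begin

lemma triangle_nondegenerate:
  assumes "T \<in> \<T>"
  shows "card T = 3" "finite T" "\<not> collinear (pt N ` T)"
  using triangulation assms unfolding periodic_triangulation_def by (auto intro: card_ge_0_finite)

lemma vertex_cover: obtains T where "T \<in> \<T>" "p \<in> T"
  using triangulation unfolding periodic_triangulation_def by (metis UNIV_I UnionE)

lemma triangle_cover: obtains T where "T \<in> \<T>" "x \<in> triangle N T"
  using triangulation unfolding periodic_triangulation_def by (metis UNIV_I UN_E)

lemma triangle_Int: "S \<in> \<T> \<Longrightarrow> T \<in> \<T> \<Longrightarrow> triangle N S \<inter> triangle N T = triangle N (S \<inter> T)"
  using triangulation unfolding periodic_triangulation_def by blast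

lemma locally_finite: "bounded K \<Longrightarrow> finite {T \<in> \<T>. triangle N T \<inter> K \<noteq> {}}"
  using triangulation unfolding periodic_triangulation_def by blast

lemma shift_in:
  "T \<in> \<T> \<Longrightarrow> (\<lambda>p. (fst p + a * int N, snd p + b * int N)) ` T \<in> \<T>"
  using triangulation unfolding periodic_triangulation_def by blast

lemma barycentric_ex: "T \<in> \<T> \<Longrightarrow> \<exists>c g. barycentric N T c g"
  by (intro barycentric_coordinates_exist triangle_nondegenerate)

lemma piecewise_affine_unique:
  assumes "piecewise_affine N \<T> u" "piecewise_affine N \<T> v" "\<And>p. u (pt N p) = v (pt N p)"
  shows "u = v"
proof
  fix x
  obtain T where T: "T \<in> \<T>" "x \<in> triangle N T" by (rule triangle_cover)
  obtain a b where u: "\<forall>x\<in>triangle N T. u x = a + b \<bullet> x"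
    by (rule piecewise_affineE[OF assms(1) T(1)])
  obtain a' b' where v: "\<forall>x\<in>triangle N T. v x = a' + b' \<bullet> x"
    by (rule piecewise_affineE[OF assms(2) T(1)])
  have "a + b \<bullet> pt N p = a' + b' \<bullet> pt N p" if "p \<in> T" for p
    using assms(3)[of p] bspec[OF u, of "pt N p"] bspec[OF v, of "pt N p"] that by (simp add: vertex_in_triangle)
  from affine_eq_on_triangle[OF this T(2)] show "u x = v x"
    using bspec[OF u T(2)] bspec[OF v T(2)] by simp
qed

text \<open>Barycentric coordinates solve the problem on each triangle. Two triangles meet in the
  hull of their common vertices, where the local solutions agree, so they glue to one
  function.\<close>

lemma piecewise_affine_ex:
  "\<exists>v. piecewise_affine N \<T> v \<and> continuous_on UNIV v \<and> (\<forall>p. v (pt N p) = f p)"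
proof -
  have "\<exists>a b. \<forall>p\<in>T. a + b \<bullet> pt N p = f p" if T: "T \<in> \<T>" for T
  proof -
    obtain c g where "barycentric N T c g" using barycentric_ex[OF T] by blast
    then interpret barycentric N T c g .
    obtain a b where ab: "\<And>x. (\<Sum>p\<in>T. f p * lam p x) = a + b \<bullet> x" using sum_lam_affine by blast
    have "a + b \<bullet> pt N q = f q" if "q \<in> T" for q
    proof -
      have "(\<Sum>p\<in>T. f p * lam p (pt N q)) = (\<Sum>p\<in>T. if p = q then f p else 0)"
        using that by (intro sum.cong refl) (auto simp: lam_vertex)
      then show ?thesis using that finite_T by (simp add: ab)
    qed
    then show ?thesis by blast
  qed
  then obtain a b where ab: "\<And>T p. T \<in> \<T> \<Longrightarrow> p \<in> T \<Longrightarrow> a T + b T \<bullet> pt N p = f p"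
    by metis
  define F where "F T x = a T + b T \<bullet> x" for T x
  have agree: "F S x = F T x" if "S \<in> \<T>" "T \<in> \<T>" "x \<in> triangle N S \<inter> triangle N T" for S T x
    unfolding F_def
  proof (rule affine_eq_on_triangle)
    show "x \<in> triangle N (S \<inter> T)" using that triangle_Int by blast
    show "a S + b S \<bullet> pt N p = a T + b T \<bullet> pt N p" if "p \<in> S \<inter> T" for p
      using ab[of S p] ab[of T p] that \<open>S \<in> \<T>\<close> \<open>T \<in> \<T>\<close> by simp
  qed
  define v where "v x = F (SOME T. T \<in> \<T> \<and> x \<in> triangle N T) x" for x
  have v: "v x = F T x" if "T \<in> \<T>" "x \<in> triangle N T" for T x
  proof -
    have "\<exists>T. T \<in> \<T> \<and> x \<in> triangle N T" using that by blast
    from someI_ex[OF this] show ?thesis using that agree unfolding v_def by blast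
  qed
  \<comment> \<open>The triangles are closed, and a unit ball meets only finitely many of them,
    which is the condition for pasting continuous functions on closed pieces.\<close>
  have "continuous_map euclidean euclidean v"
  proof (rule pasting_lemma_locally_finite[where I = \<T> and T = "triangle N" and f = F])
    show "\<exists>V. openin euclidean V \<and> x \<in> V \<and> finite {i \<in> \<T>. triangle N i \<inter> V \<noteq> {}}" for x
      by (intro exI[of _ "ball x 1"]) (auto intro: locally_finite)
    show "closedin euclidean (triangle N i)" if "i \<in> \<T>" for i
      using compact_triangle[OF triangle_nondegenerate(2)[OF that]] by (simp add: compact_imp_closed)
    show "continuous_map (top_of_set (triangle N i)) euclidean (F i)" for i
      by (auto simp: F_def[abs_def] intro!: continuous_intros)
    show "F i x = F j x" if "i \<in> \<T>" "j \<in> \<T>" "x \<in> topspace euclidean \<inter> triangle N i \<inter> triangle N j" for i j x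
      using agree[OF that(1,2), of x] that(3) by simp
    show "\<exists>j. j \<in> \<T> \<and> x \<in> triangle N j \<and> v x = F j x" for x
      by (rule triangle_cover[of x]) (use v in blast)
  qed
  then have "continuous_on UNIV v" by simp
  moreover have "piecewise_affine N \<T> v"
    unfolding piecewise_affine_def
  proof
    fix T assume "T \<in> \<T>"
    then show "\<exists>c g. \<forall>x\<in>triangle N T. v x = c + g \<bullet> x"
      by (intro exI[of _ "a T"] exI[of _ "b T"]) (simp add: v F_def)
  qed
  moreover have "v (pt N p) = f p" for p
  proof -
    obtain T where "T \<in> \<T>" "p \<in> T" by (rule vertex_cover)
    then show ?thesis using v[of T "pt N p"] ab by (simp add: vertex_in_triangle F_def)
  qed
  ultimately show ?thesis by blast
qed

lemma piecewise_affine_shift: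
  assumes "piecewise_affine N \<T> v"
  shows "piecewise_affine N \<T> (\<lambda>x. v ((2 * pi * of_int a, 2 * pi * of_int b) + x))"
  unfolding piecewise_affine_def
proof
  fix T assume T: "T \<in> \<T>"
  let ?t = "(2 * pi * of_int a, 2 * pi * of_int b) :: real \<times> real"
  let ?T = "(\<lambda>p. (fst p + a * int N, snd p + b * int N)) ` T"
  obtain c g where cg: "\<forall>x\<in>triangle N ?T. v x = c + g \<bullet> x"
    by (rule piecewise_affineE[OF assms shift_in[OF T, of a b]])
  have "v (?t + x) = (c + g \<bullet> ?t) + g \<bullet> x" if "x \<in> triangle N T" for x
    using that by (subst bspec[OF cg]) (auto simp: triangle_shift[OF N_pos] inner_add_right)
  then show "\<exists>c g. \<forall>x\<in>triangle N T. v (?t + x) = c + g \<bullet> x" by blast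
qed

text \<open>A translate by a period is affine on every triangle, since the mesh is invariant, and
  has the same nodal values; uniqueness identifies it with \<open>v\<close>.\<close>

lemma piecewise_affine_periodic:
  assumes v: "piecewise_affine N \<T> v" and "\<And>p. v (pt N p) = f p" and f: "f \<in> grid_functions N"
  shows "v (x + 2 * pi, y) = v (x, y)" "v (x, y + 2 * pi) = v (x, y)"
proof -
  have "(\<lambda>x. v ((2 * pi * of_int a, 2 * pi * of_int b) + x)) = v"
    if "\<And>p. f (fst p + a * int N, snd p + b * int N) = f p" for a b
    by (rule piecewise_affine_unique[OF piecewise_affine_shift[OF v] v])
      (simp add: assms(2) that flip: pt_shift[OF N_pos])
  note * = fun_cong[OF this]
  have "f (fst p + 1 * int N, snd p + 0 * int N) = f p"
    "f (fst p + 0 * int N, snd p + 1 * int N) = f p" for p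
    using f by (simp_all add: grid_functions_def)
  from *[OF this(1), of "(x, y)"] *[OF this(2), of "(x, y)"]
  show "v (x + 2 * pi, y) = v (x, y)" "v (x, y + 2 * pi) = v (x, y)"
    by (simp_all add: add.commute)
qed

lemma pl_space_piecewise_affine: "v \<in> pl_space N \<T> \<Longrightarrow> piecewise_affine N \<T> v"
  by (simp add: pl_space_def piecewise_affine_def)

lemma pl_interp_unique:
  assumes "u \<in> pl_space N \<T>" "\<And>p. u (pt N p) = f p"
  shows "pl_interp N \<T> f = u"
  unfolding pl_interp_def
proof (rule the_equality)
  show "u \<in> pl_space N \<T> \<and> (\<forall>p. u (pt N p) = f p)" using assms by blast
  fix v assume "v \<in> pl_space N \<T> \<and> (\<forall>p. v (pt N p) = f p)"
  then show "v = u"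
    using assms by (intro piecewise_affine_unique) (simp_all add: pl_space_piecewise_affine del: split_paired_All)
qed

lemma pl_interp:
  assumes "f \<in> grid_functions N"
  shows "pl_interp N \<T> f \<in> pl_space N \<T>" "pl_interp N \<T> f (pt N p) = f p"
proof -
  obtain v where v: "piecewise_affine N \<T> v" "continuous_on UNIV v" "\<And>p. v (pt N p) = f p"
    using piecewise_affine_ex by blast
  then have "v \<in> pl_space N \<T>"
    using piecewise_affine_periodic[OF v(1,3) assms]
    by (auto simp: pl_space_def piecewise_affine_def)
  moreover from pl_interp_unique[OF this v(3)] have "pl_interp N \<T> f = v" .
  ultimately show "pl_interp N \<T> f \<in> pl_space N \<T>" "pl_interp N \<T> f (pt N p) = f p"
    using v(3) by simp_all
qed

lemma pl_space_lin:
  assumes "u \<in> pl_space N \<T>" "v \<in> pl_space N \<T>"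
  shows "(\<lambda>x. a * u x + v x) \<in> pl_space N \<T>"
proof -
  have "\<exists>c g. \<forall>x\<in>triangle N T. a * u x + v x = c + g \<bullet> x" if T: "T \<in> \<T>" for T
  proof -
    obtain c g where "\<forall>x\<in>triangle N T. u x = c + g \<bullet> x"
      by (rule piecewise_affineE[OF pl_space_piecewise_affine[OF assms(1)] T])
    moreover obtain c' g' where "\<forall>x\<in>triangle N T. v x = c' + g' \<bullet> x"
      by (rule piecewise_affineE[OF pl_space_piecewise_affine[OF assms(2)] T])
    ultimately show ?thesis
      by (intro exI[of _ "a * c + c'"] exI[of _ "a *\<^sub>R g + g'"]) (simp add: algebra_simps)
  qed
  then show ?thesis
    using assms by (auto simp: pl_space_def intro!: continuous_intros)
qed

lemma pl_interp_lin:
  assumes "f \<in> grid_functions N" "h \<in> grid_functions N"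
  shows "pl_interp N \<T> (\<lambda>p. a * f p + h p) = (\<lambda>x. a * pl_interp N \<T> f x + pl_interp N \<T> h x)"
  using assms by (intro pl_interp_unique pl_space_lin) (simp_all add: pl_interp)

end

section \<open>Averaged gradients\<close>

lemma grad_eq:
  assumes "GDERIV f x :> D"
  shows "grad f x = D"
  unfolding grad_def
proof (rule the_equality[where P = "\<lambda>D. GDERIV f x :> D", OF assms])
  fix E assume "GDERIV f x :> E"
  then have "(\<lambda>h. h \<bullet> E) = (\<lambda>h. h \<bullet> D)"
    using assms unfolding gderiv_def by (rule has_derivative_unique)
  then show "E = D"
    by (metis inner_commute vector_eq_ldot)
qed

lemma GDERIV_affine: "GDERIV (\<lambda>x. c + g \<bullet> x) x :> g"
  unfolding gderiv_def by (auto intro!: derivative_eq_intros simp: inner_commute)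

context mesh
begin

lemma GDERIV_piecewise_affine:
  assumes "piecewise_affine N \<T> v" "T \<in> \<T>"
  obtains g where "\<And>x. x \<in> interior (triangle N T) \<Longrightarrow> GDERIV v x :> g"
proof -
  obtain c g where v: "\<forall>x\<in>triangle N T. v x = c + g \<bullet> x"
    by (rule piecewise_affineE[OF assms])
  have "GDERIV v x :> g" if "x \<in> interior (triangle N T)" for x
    using GDERIV_affine[of c g x] unfolding gderiv_def
    by (rule has_derivative_transform_within_open[OF _ open_interior that])
      (use v in \<open>simp add: subsetD[OF interior_subset]\<close>)
  then show ?thesis by (rule that)
qed

text \<open>A vertex of \<open>e\<close> lies in every triangle of the patch, so local finiteness at
  that single point suffices. Finiteness is used both for the integral over the patch and for the
  null set of frontiers.\<close>

lemma edge_patch_finite: "e \<noteq> {} \<Longrightarrow> finite {T \<in> \<T>. e \<subseteq> T}"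
proof -
  assume "e \<noteq> {}"
  then obtain p where "p \<in> e" by blast
  then have "{T \<in> \<T>. e \<subseteq> T} \<subseteq> {T \<in> \<T>. triangle N T \<inter> {pt N p} \<noteq> {}}"
    by (auto simp: vertex_in_triangle)
  then show ?thesis
    by (rule finite_subset) (rule locally_finite, simp)
qed

lemma negligible_frontier_triangle: "negligible (frontier (triangle N T))"
  by (intro negligible_convex_frontier) (simp add: triangle_def)

lemma negligible_patch_frontiers:
  "e \<noteq> {} \<Longrightarrow> negligible (\<Union>T\<in>{T \<in> \<T>. e \<subseteq> T}. frontier (triangle N T))"
  by (intro negligible_Union) (auto simp: edge_patch_finite negligible_frontier_triangle)

lemma patch_interior:
  assumes "x \<in> edge_patch N \<T> e - (\<Union>T\<in>{T \<in> \<T>. e \<subseteq> T}. frontier (triangle N T))"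
  obtains T where "T \<in> \<T>" "x \<in> interior (triangle N T)"
  using assms interior_subset closure_subset by (fastforce simp: edge_patch_def frontier_def)

text \<open>On each triangle the gradient is constant off the frontier, which is null because the
  triangle is convex. Absolute integrability is used because it passes to the finite union forming
  the patch.\<close>

lemma grad_integrable:
  assumes "piecewise_affine N \<T> v" "e \<noteq> {}"
  shows "grad v integrable_on edge_patch N \<T> e"
proof -
  have "grad v absolutely_integrable_on triangle N T" and "triangle N T \<in> sets lebesgue"
    if T: "T \<in> \<T>" for T
  proof -
    have cpt: "compact (triangle N T)" by (rule compact_triangle[OF triangle_nondegenerate(2)[OF T]])
    then show "triangle N T \<in> sets lebesgue"
      by (simp add: compact_imp_closed lmeasurable_compact)
    obtain g where g: "\<And>x. x \<in> interior (triangle N T) \<Longrightarrow> GDERIV v x :> g"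
      using GDERIV_piecewise_affine[OF assms(1) T] by blast
    have "(\<lambda>x. g) absolutely_integrable_on triangle N T"
      by (rule absolutely_integrable_on_const[OF lmeasurable_compact[OF cpt]])
    then show "grad v absolutely_integrable_on triangle N T"
      by (rule absolutely_integrable_spike[OF _ negligible_frontier_triangle])
        (use closure_subset in \<open>auto simp: frontier_def intro!: grad_eq g\<close>)
  qed
  then have "grad v absolutely_integrable_on edge_patch N \<T> e"
    unfolding edge_patch_def
    by (intro set_integrable_UN) (auto simp: edge_patch_finite[OF assms(2)])
  then show ?thesis by (rule set_lebesgue_integral_eq_integral)
qed

lemma avg_grad_lin:
  assumes "u \<in> pl_space N \<T>" "v \<in> pl_space N \<T>" "e \<noteq> {}"
  shows "avg_grad N \<T> (\<lambda>x. a * u x + v x) e = a *\<^sub>R avg_grad N \<T> u e + avg_grad N \<T> v e"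
proof -
  let ?P = "edge_patch N \<T> e"
  note pa = pl_space_piecewise_affine[OF assms(1)] pl_space_piecewise_affine[OF assms(2)]
  have "integral ?P (grad (\<lambda>x. a * u x + v x)) = integral ?P (\<lambda>x. a *\<^sub>R grad u x + grad v x)"
  \<comment> \<open>Off the frontiers both functions are differentiable, and only there can the
    gradient of the combination be computed.\<close>
  proof (rule integral_spike[OF negligible_patch_frontiers[OF assms(3)]])
    fix x assume "x \<in> ?P - (\<Union>T\<in>{T \<in> \<T>. e \<subseteq> T}. frontier (triangle N T))"
    then obtain T where T: "T \<in> \<T>" "x \<in> interior (triangle N T)" by (rule patch_interior)
    obtain g where g: "GDERIV u x :> g"
      using GDERIV_piecewise_affine[OF pa(1) T(1)] T(2) by blast
    obtain h where h: "GDERIV v x :> h"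
      using GDERIV_piecewise_affine[OF pa(2) T(1)] T(2) by blast
    have "GDERIV (\<lambda>x. a * u x + v x) x :> a *\<^sub>R g + h"
      using GDERIV_add[OF GDERIV_mult[OF GDERIV_const g] h] by simp
    then show "a *\<^sub>R grad u x + grad v x = grad (\<lambda>x. a * u x + v x) x"
      by (simp add: grad_eq[OF g] grad_eq[OF h] grad_eq)
  qed
  also have "\<dots> = a *\<^sub>R integral ?P (grad u) + integral ?P (grad v)"
    using grad_integrable[OF pa(1) assms(3)] grad_integrable[OF pa(2) assms(3)]
    by (simp add: integral_add integrable_cmul)
  finally show ?thesis by (simp add: avg_grad_def scaleR_right_distrib)
qed

end

section \<open>Unisolvence of the Morley element\<close>

lemma quadratic_gderiv:
  assumes "quadratic w"
  obtains D where "continuous_on UNIV D" "\<forall>x. GDERIV w x :> D x"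
proof -
  obtain a b c d e f where w: "\<And>x y. w (x, y) = a + b * x + c * y + d * x\<^sup>2 + e * x * y + f * y\<^sup>2"
    using assms unfolding quadratic_def by blast
  then have w: "w = (\<lambda>z. a + b * fst z + c * snd z + d * (fst z)\<^sup>2 + e * fst z * snd z + f * (snd z)\<^sup>2)"
    by (auto simp: fun_eq_iff)
  define D where "D z = (b + 2 * d * fst z + e * snd z, c + e * fst z + 2 * f * snd z)" for z :: "real \<times> real"
  have "continuous_on UNIV D"
    unfolding D_def by (intro continuous_intros)
  moreover have "GDERIV w x :> D x" for x
    unfolding gderiv_def w D_def
    by (rule derivative_eq_intros refl | simp)+ (auto simp: inner_prod_def fun_eq_iff algebra_simps)
  ultimately show ?thesis using that by blast
qed

lemma quadratic_GDERIV_grad: "quadratic w \<Longrightarrow> GDERIV w x :> grad w x"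
proof -
  assume "quadratic w"
  then obtain D where "GDERIV w x :> D x" by (metis quadratic_gderiv)
  then show ?thesis by (simp only: grad_eq)
qed

lemma continuous_on_grad_quadratic: "quadratic w \<Longrightarrow> continuous_on A (grad w)"
proof -
  assume "quadratic w"
  then obtain D where D: "continuous_on UNIV D" "\<forall>x. GDERIV w x :> D x"
    by (rule quadratic_gderiv)
  have "grad w = D" by (rule ext, rule grad_eq, rule spec[OF D(2)])
  then show ?thesis using continuous_on_subset[OF D(1) subset_UNIV] by simp
qed

lemma quadratic_lin:
  assumes "quadratic u" "quadratic v"
  shows "quadratic (\<lambda>x. a * u x + v x)"
proof -
  obtain a1 b1 c1 d1 e1 f1 where u: "\<And>x y. u (x, y) = a1 + b1 * x + c1 * y + d1 * x\<^sup>2 + e1 * x * y + f1 * y\<^sup>2"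
    using assms(1) unfolding quadratic_def by blast
  obtain a2 b2 c2 d2 e2 f2 where v: "\<And>x y. v (x, y) = a2 + b2 * x + c2 * y + d2 * x\<^sup>2 + e2 * x * y + f2 * y\<^sup>2"
    using assms(2) unfolding quadratic_def by blast
  show ?thesis
    unfolding quadratic_def u v
    by (rule exI[of _ "a * a1 + a2"], rule exI[of _ "a * b1 + b2"], rule exI[of _ "a * c1 + c2"],
        rule exI[of _ "a * d1 + d2"], rule exI[of _ "a * e1 + e2"], rule exI[of _ "a * f1 + f2"])
      (simp add: algebra_simps)
qed

lemma quadratic_zero: "quadratic (\<lambda>_. 0)"
  unfolding quadratic_def by (intro exI[of _ 0]) simp

lemma quadratic_affine_mult: "quadratic (\<lambda>x. (a + b \<bullet> x) * (c + d \<bullet> x))"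
  unfolding quadratic_def
  by (rule exI[of _ "a * c"], rule exI[of _ "a * fst d + fst b * c"], rule exI[of _ "a * snd d + snd b * c"],
      rule exI[of _ "fst b * fst d"], rule exI[of _ "fst b * snd d + snd b * fst d"], rule exI[of _ "snd b * snd d"])
    (simp add: inner_prod_def algebra_simps power2_eq_square)

lemma quadratic_sum:
  assumes "finite A" "\<And>i. i \<in> A \<Longrightarrow> quadratic (f i)"
  shows "quadratic (\<lambda>x. \<Sum>i\<in>A. f i x)"
  using assms
proof (induction A)
  case empty
  then show ?case by (simp add: quadratic_zero)
next
  case (insert i A)
  then show ?case using quadratic_lin[of "f i" "\<lambda>x. \<Sum>i\<in>A. f i x" 1] by simp
qed

lemma grad_lin:
  assumes "quadratic u" "quadratic v"
  shows "grad (\<lambda>x. a * u x + v x) x = a *\<^sub>R grad u x + grad v x"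
  by (rule grad_eq, rule GDERIV_subst,
      rule GDERIV_add[OF GDERIV_mult[OF GDERIV_const quadratic_GDERIV_grad[OF assms(1)]]
        quadratic_GDERIV_grad[OF assms(2)]]) simp

lemma endpoints_eq:
  assumes "card e = 2"
  shows "e = {fst (endpoints e), snd (endpoints e)}" "fst (endpoints e) \<noteq> snd (endpoints e)"
proof -
  obtain p q where "e = {p, q}" using assms by (auto simp: card_2_iff)
  then have "\<exists>z. case z of (p, q) \<Rightarrow> e = {p, q}" by (intro exI[of _ "(p, q)"]) simp
  from someI_ex[OF this] show *: "e = {fst (endpoints e), snd (endpoints e)}"
    by (simp add: endpoints_def case_prod_unfold)
  show "fst (endpoints e) \<noteq> snd (endpoints e)"
  proof
    assume "fst (endpoints e) = snd (endpoints e)"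
    with arg_cong[OF *, of card] show False using assms by simp
  qed
qed

context barycentric
begin

text \<open>An affine function takes at a midpoint the mean of its end values: 1/2 for an endpoint
  of the edge and 0 for the opposite vertex.\<close>

lemma lam_edge_mid:
  assumes "card e = 2" "e \<subseteq> T" "p \<in> T"
  shows "lam p (edge_mid N e) = of_bool (p \<in> e) / 2"
proof -
  obtain a b where ab: "endpoints e = (a, b)" by (cases "endpoints e")
  then have e: "e = {a, b}" "a \<noteq> b" using endpoints_eq[OF assms(1)] by auto
  have "lam p (edge_mid N e) = (lam p (pt N a) + lam p (pt N b)) / 2"
    by (simp add: edge_mid_def edge_start_def edge_end_def ab lam_def midpoint_def inner_add_right add_divide_distrib)
  also have "\<dots> = of_bool (p \<in> e) / 2"
    using assms e by (auto simp: lam_vertex)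
  finally show ?thesis .
qed

lemma g_nonzero:
  assumes "p \<in> T"
  shows "g p \<noteq> 0"
proof
  assume "g p = 0"
  have "T \<noteq> {p}" using card_T by auto
  then obtain q where "q \<in> T" "q \<noteq> p" using assms by blast
  then show False
    using vertex[of p p] vertex[of p q] assms \<open>g p = 0\<close> by simp
qed

text \<open>The coordinate of \<open>r\<close> vanishes at both ends of the opposite edge, so its
  gradient is normal to that edge.\<close>

lemma g_normal:
  assumes "r \<in> T" "e = T - {r}"
  shows "g r \<bullet> (edge_end N e - edge_start N e) = 0" "edge_end N e \<noteq> edge_start N e"
proof -
  have "card e = 2" using assms card_T finite_T by simp
  obtain a b where ab: "endpoints e = (a, b)" by (cases "endpoints e")
  then have e: "e = {a, b}" "a \<noteq> b" using endpoints_eq[OF \<open>card e = 2\<close>] by auto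
  then have T: "a \<in> T" "b \<in> T" "a \<noteq> r" "b \<noteq> r" using assms by auto
  have "lam r (pt N a) = 0" "lam r (pt N b) = 0" using T assms by (auto simp: lam_vertex)
  then show "g r \<bullet> (edge_end N e - edge_start N e) = 0"
    by (simp add: edge_start_def edge_end_def ab lam_def inner_diff_right)
  have "lam a (pt N a) \<noteq> lam a (pt N b)" using T e by (simp add: lam_vertex)
  then show "edge_end N e \<noteq> edge_start N e"
    by (auto simp: edge_start_def edge_end_def ab)
qed

lemma unit_normal_parallel:
  assumes "r \<in> T" "e = T - {r}" "unit_normal N e n"
  obtains k where "n = k *\<^sub>R g r"
proof -
  obtain x y where E: "edge_end N e - edge_start N e = (x, y)" by (cases "edge_end N e - edge_start N e")
  obtain n1 n2 where n: "n = (n1, n2)" by (cases n)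
  obtain g1 g2 where g: "g r = (g1, g2)" by (cases "g r")
  have 1: "n1 * x + n2 * y = 0" using assms(3) by (simp add: unit_normal_def E n)
  have 2: "g1 * x + g2 * y = 0" using g_normal(1)[OF assms(1,2)] by (simp add: E g)
  have "(x, y) \<noteq> 0" using g_normal(2)[OF assms(1,2)] E by (metis eq_iff_diff_eq_0)
  then have "n1 * g2 = n2 * g1" using 1 2 by (simp add: zero_prod_def) algebra
  moreover have g0: "g1\<^sup>2 + g2\<^sup>2 \<noteq> 0"
    using g_nonzero[OF assms(1)] by (simp add: g zero_prod_def sum_power2_eq_zero_iff)
  \<comment> \<open>In the plane the normals of a nondegenerate edge form one line; the factor is
    \<open>n \<bullet> g r\<close> divided by the squared length of \<open>g r\<close>.\<close>
  ultimately have "n1 = (n1 * g1 + n2 * g2) / (g1\<^sup>2 + g2\<^sup>2) * g1" "n2 = (n1 * g1 + n2 * g2) / (g1\<^sup>2 + g2\<^sup>2) * g2"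
    by (simp_all add: field_simps power2_eq_square)
  then show ?thesis using that[of "(n1 * g1 + n2 * g2) / (g1\<^sup>2 + g2\<^sup>2)"] by (simp add: n g)
qed

text \<open>Replaces the condition for all unit normals by one scalar equation per vertex, with the
  unnormalized normal \<open>g r\<close>. The sign of the normal cancels since both sides are linear
  in it.\<close>

lemma normal_condition_iff:
  assumes "r \<in> T" "e = T - {r}"
  shows "(\<forall>n. unit_normal N e n \<longrightarrow> n \<bullet> a = n \<bullet> b) \<longleftrightarrow> g r \<bullet> a = g r \<bullet> b"
proof
  assume *: "\<forall>n. unit_normal N e n \<longrightarrow> n \<bullet> a = n \<bullet> b"
  have "unit_normal N e ((1 / norm (g r)) *\<^sub>R g r)"
    using g_nonzero[OF assms(1)] g_normal(1)[OF assms] by (simp add: unit_normal_def)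
  with * have "((1 / norm (g r)) *\<^sub>R g r) \<bullet> a = ((1 / norm (g r)) *\<^sub>R g r) \<bullet> b" by blast
  then show "g r \<bullet> a = g r \<bullet> b" using g_nonzero[OF assms(1)] by simp
next
  assume *: "g r \<bullet> a = g r \<bullet> b"
  show "\<forall>n. unit_normal N e n \<longrightarrow> n \<bullet> a = n \<bullet> b"
  proof (intro allI impI)
    fix n assume "unit_normal N e n"
    then obtain k where "n = k *\<^sub>R g r" by (rule unit_normal_parallel[OF assms])
    then show "n \<bullet> a = n \<bullet> b" using * by simp
  qed
qed

lemma edge_iff: "card e = 2 \<and> e \<subseteq> T \<longleftrightarrow> (\<exists>r\<in>T. e = T - {r})"
proof
  assume e: "card e = 2 \<and> e \<subseteq> T"
  then have "card (T - e) = 1" using card_T finite_T card_Diff_subset[of e T] finite_subset[of e T] by simp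
  then obtain r where "T - e = {r}" by (auto simp: card_1_singleton_iff)
  then show "\<exists>r\<in>T. e = T - {r}" using e by blast
next
  assume "\<exists>r\<in>T. e = T - {r}"
  then show "card e = 2 \<and> e \<subseteq> T" using card_T finite_T by auto
qed

lemma opposite_edge:
  assumes "r \<in> T"
  shows "card (T - {r}) = 2" "T - {r} \<subseteq> T"
  using edge_iff[of "T - {r}"] assms by blast+

lemma lam_GDERIV: "GDERIV (lam p) x :> g p"
  unfolding lam_def[abs_def] by (rule GDERIV_affine)

text \<open>
  The bubble \<open>\<lambda> (1 - \<lambda>)\<close> of a vertex vanishes at all vertices, and its gradient vanishes at the
  midpoints of the two edges through that vertex, so the edge data decouple.
\<close>

lemma morley_local_ex:
  "\<exists>w. quadratic w \<and> (\<forall>p\<in>T. w (pt N p) = f p) \<and>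
       (\<forall>r\<in>T. g r \<bullet> grad w (edge_mid N (T - {r})) = g r \<bullet> G (T - {r}))"
proof -
  \<comment> \<open>At the midpoint opposite \<open>r\<close> the coordinate of \<open>r\<close> is
    0, so the bubble of \<open>r\<close> has gradient \<open>g r\<close> there. Hence
    \<open>k r\<close> is the \<open>g r\<close> component missing from the gradient of the affine
    interpolant, divided by \<open>g r \<bullet> g r\<close>.\<close>
  define k where "k r = g r \<bullet> (G (T - {r}) - (\<Sum>p\<in>T. f p *\<^sub>R g p)) / (g r \<bullet> g r)" for r
  define w where "w x = (\<Sum>p\<in>T. f p * lam p x + k p * (lam p x * (1 - lam p x)))" for x
  have "quadratic (\<lambda>x. f p * lam p x + k p * (lam p x * (1 - lam p x)))" for p
  proof -
    have "(\<lambda>x. f p * lam p x + k p * (lam p x * (1 - lam p x)))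
        = (\<lambda>x. (c p + g p \<bullet> x) * ((f p + k p - k p * c p) + (- k p *\<^sub>R g p) \<bullet> x))"
      by (auto simp: lam_def algebra_simps)
    then show ?thesis by (simp only: quadratic_affine_mult)
  qed
  then have "quadratic w"
    unfolding w_def[abs_def] by (intro quadratic_sum finite_T)
  moreover have "w (pt N q) = f q" if "q \<in> T" for q
  proof -
    have "w (pt N q) = (\<Sum>p\<in>T. if p = q then f p else 0)"
      unfolding w_def using that by (intro sum.cong refl) (auto simp: lam_vertex)
    then show ?thesis using that finite_T by simp
  qed
  moreover have "g r \<bullet> grad w (edge_mid N (T - {r})) = g r \<bullet> G (T - {r})" if r: "r \<in> T" for r
  proof -
    let ?m = "edge_mid N (T - {r})"
    have m: "lam p ?m = of_bool (p \<noteq> r) / 2" if "p \<in> T" for p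
      using lam_edge_mid[OF opposite_edge[OF r] that] that by simp
    have "GDERIV w x :> (\<Sum>p\<in>T. (f p + k p * (1 - 2 * lam p x)) *\<^sub>R g p)" for x
      unfolding gderiv_def w_def[abs_def] lam_def
      by (rule derivative_eq_intros refl | simp)+
        (auto simp: fun_eq_iff inner_sum_right inner_commute algebra_simps intro!: sum.cong)
    then have "grad w ?m = (\<Sum>p\<in>T. (f p + k p * (1 - 2 * lam p ?m)) *\<^sub>R g p)"
      by (rule grad_eq)
    also have "\<dots> = (\<Sum>p\<in>T. f p *\<^sub>R g p + (if p = r then k p *\<^sub>R g p else 0))"
      by (intro sum.cong refl) (auto simp: m scaleR_left_distrib)
    also have "\<dots> = (\<Sum>p\<in>T. f p *\<^sub>R g p) + k r *\<^sub>R g r"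
      using r finite_T by (simp add: sum.distrib)
    finally show ?thesis
      using g_nonzero[OF r] by (simp add: k_def inner_add_right inner_diff_right)
  qed
  ultimately show ?thesis by blast
qed

text \<open>In barycentric coordinates a quadratic polynomial becomes a quadratic form whose
  diagonal entries are the vertex values, so only mixed products remain.\<close>

lemma quadratic_barycentric:
  assumes T: "T = {P, Q, R}" "P \<noteq> Q" "P \<noteq> R" "Q \<noteq> R"
    and w: "quadratic w" "\<And>p. p \<in> T \<Longrightarrow> w (pt N p) = 0"
  obtains \<alpha> \<beta> \<gamma> where
    "\<And>x. w x = \<alpha> * (lam Q x * lam R x) + \<beta> * (lam R x * lam P x) + \<gamma> * (lam P x * lam Q x)"
proof -
  obtain a b c d e f where wf: "\<And>x y. w (x, y) = a + b * x + c * y + d * x\<^sup>2 + e * x * y + f * y\<^sup>2"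
    using w(1) unfolding quadratic_def by blast
  \<comment> \<open>Twice the polar form of the homogenized polynomial, so that \<open>B p p\<close>
    is \<open>2 * w p\<close>; its values at pairs of vertices are the mixed coefficients.\<close>
  define B where "B p q = 2 * a + b * (fst p + fst q) + c * (snd p + snd q) + 2 * d * (fst p * fst q)
    + e * (fst p * snd q + fst q * snd p) + 2 * f * (snd p * snd q)" for p q :: "real \<times> real"
  have "w x = B (pt N Q) (pt N R) * (lam Q x * lam R x) + B (pt N R) (pt N P) * (lam R x * lam P x)
      + B (pt N P) (pt N Q) * (lam P x * lam Q x)" for x
  proof -
    obtain px py qx qy rx ry where pq: "pt N P = (px, py)" "pt N Q = (qx, qy)" "pt N R = (rx, ry)"
      by (metis surj_pair)
    define l m n where "l = lam P x" and "m = lam Q x" and "n = lam R x"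
    \<comment> \<open>The coordinates sum to 1. Inserting powers of \<open>s\<close> makes every
      term homogeneous of degree two in \<open>l\<close>, \<open>m\<close>,
      \<open>n\<close>.\<close>
    define s where "s = l + m + n"
    have s: "s = 1" using sum_lam[of x] T by (simp add: s_def l_def m_def n_def add.assoc)
    have x: "x = (l * px + m * qx + n * rx, l * py + m * qy + n * ry)"
      using sum_lam_pt[of x] T by (simp add: pq l_def m_def n_def add.assoc)
    have w0: "w (px, py) = 0" "w (qx, qy) = 0" "w (rx, ry) = 0"
      using w(2) T by (auto simp flip: pq)
    define X Y where "X = l * px + m * qx + n * rx" and "Y = l * py + m * qy + n * ry"
    have "w x = a * s\<^sup>2 + b * X * s + c * Y * s + d * X\<^sup>2 + e * X * Y + f * Y\<^sup>2"
      by (simp add: s x wf X_def Y_def)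
    also have "\<dots> = l\<^sup>2 * w (px, py) + m\<^sup>2 * w (qx, qy) + n\<^sup>2 * w (rx, ry)
        + B (qx, qy) (rx, ry) * (m * n) + B (rx, ry) (px, py) * (n * l) + B (px, py) (qx, qy) * (l * m)"
      by (simp add: wf X_def Y_def s_def B_def power2_eq_square algebra_simps)
    finally show ?thesis by (simp add: w0 pq l_def m_def n_def)
  qed
  then show ?thesis by (rule that)
qed

text \<open>Because the three gradients sum to zero, the gradient at the midpoint opposite a vertex
  is a multiple of the gradient belonging to that vertex. The normal conditions force the three
  multipliers to vanish, and adding them in pairs yields each coefficient.\<close>

lemma morley_local_zero:
  assumes w: "quadratic w" "\<And>p. p \<in> T \<Longrightarrow> w (pt N p) = 0"
    "\<And>r. r \<in> T \<Longrightarrow> g r \<bullet> grad w (edge_mid N (T - {r})) = 0"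
  shows "w = (\<lambda>_. 0)"
proof -
  obtain P Q R where T: "T = {P, Q, R}" and ne: "P \<noteq> Q" "P \<noteq> R" "Q \<noteq> R"
    using card_T by (auto simp: card_3_iff)
  obtain \<alpha> \<beta> \<gamma> where
    W: "\<And>x. w x = \<alpha> * (lam Q x * lam R x) + \<beta> * (lam R x * lam P x) + \<gamma> * (lam P x * lam Q x)"
    using quadratic_barycentric[OF T ne w(1,2)] by blast
  have gw: "grad w x = \<alpha> *\<^sub>R (lam Q x *\<^sub>R g R + lam R x *\<^sub>R g Q)
      + \<beta> *\<^sub>R (lam R x *\<^sub>R g P + lam P x *\<^sub>R g R) + \<gamma> *\<^sub>R (lam P x *\<^sub>R g Q + lam Q x *\<^sub>R g P)" for x
    unfolding W[abs_def]
    by (rule grad_eq, rule GDERIV_subst,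
        rule GDERIV_add[OF GDERIV_add[OF GDERIV_mult[OF GDERIV_const GDERIV_mult[OF lam_GDERIV lam_GDERIV]]
          GDERIV_mult[OF GDERIV_const GDERIV_mult[OF lam_GDERIV lam_GDERIV]]]
          GDERIV_mult[OF GDERIV_const GDERIV_mult[OF lam_GDERIV lam_GDERIV]]]) simp
  have m: "lam p (edge_mid N (T - {r})) = of_bool (p \<noteq> r) / 2" if "p \<in> T" "r \<in> T" for p r
    using lam_edge_mid[OF opposite_edge[OF that(2)] that(1)] that by simp
  have in_T: "P \<in> T" "Q \<in> T" "R \<in> T" by (auto simp: T)
  have sg: "g P + g Q + g R = 0" using sum_g ne by (simp add: T add.assoc)
  have "grad w (edge_mid N (T - {P})) = ((\<beta> + \<gamma> - \<alpha>) / 2) *\<^sub>R g P"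
  proof -
    have "g Q + g R = - g P" using sg by (simp add: eq_neg_iff_add_eq_0 add_ac)
    then have "(\<alpha> / 2) *\<^sub>R (g R + g Q) = - (\<alpha> / 2) *\<^sub>R g P" by (simp add: add.commute)
    then show ?thesis using ne by (simp add: gw m in_T scaleR_right_distrib add_divide_distrib diff_divide_distrib algebra_simps)
  qed
  moreover have "grad w (edge_mid N (T - {Q})) = ((\<gamma> + \<alpha> - \<beta>) / 2) *\<^sub>R g Q"
  proof -
    have "g P + g R = - g Q" using sg by (simp add: eq_neg_iff_add_eq_0 add_ac)
    then have "(\<beta> / 2) *\<^sub>R (g P + g R) = - (\<beta> / 2) *\<^sub>R g Q" by simp
    then show ?thesis using ne by (simp add: gw m in_T scaleR_right_distrib add_divide_distrib diff_divide_distrib algebra_simps)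
  qed
  moreover have "grad w (edge_mid N (T - {R})) = ((\<alpha> + \<beta> - \<gamma>) / 2) *\<^sub>R g R"
  proof -
    have "g P + g Q = - g R" using sg by (simp add: eq_neg_iff_add_eq_0 add_ac)
    then have "(\<gamma> / 2) *\<^sub>R (g P + g Q) = - (\<gamma> / 2) *\<^sub>R g R" by simp
    then show ?thesis using ne by (simp add: gw m in_T scaleR_right_distrib add_divide_distrib diff_divide_distrib algebra_simps)
  qed
  ultimately have "\<beta> + \<gamma> - \<alpha> = 0" "\<gamma> + \<alpha> - \<beta> = 0" "\<alpha> + \<beta> - \<gamma> = 0"
    using w(3)[OF in_T(1)] w(3)[OF in_T(2)] w(3)[OF in_T(3)] g_nonzero in_T by auto
  then have "\<alpha> = 0" "\<beta> = 0" "\<gamma> = 0" by auto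
  then show ?thesis by (simp add: fun_eq_iff W)
qed

end

declare split_paired_All [simp del]

text \<open>The element problem on one triangle. The data \<open>f\<close> and \<open>G\<close> are
  arguments of their own, not derived from a function \<open>v\<close>, so that solutions can be
  combined linearly together with their data.\<close>

definition morley_local ::
  "nat \<Rightarrow> index set \<Rightarrow> (index \<Rightarrow> real) \<Rightarrow> (index set \<Rightarrow> real \<times> real) \<Rightarrow> (real \<times> real \<Rightarrow> real) \<Rightarrow> bool" where
  "morley_local N T f G w \<longleftrightarrow> quadratic w \<and> (\<forall>p\<in>T. w (pt N p) = f p) \<and>
     (\<forall>e n. card e = 2 \<and> e \<subseteq> T \<and> unit_normal N e n \<longrightarrow> n \<bullet> grad w (edge_mid N e) = n \<bullet> G e)"

lemma morley_localD:
  assumes "morley_local N T f G w"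
  shows "quadratic w" "p \<in> T \<Longrightarrow> w (pt N p) = f p"
    "card e = 2 \<Longrightarrow> e \<subseteq> T \<Longrightarrow> unit_normal N e n \<Longrightarrow> n \<bullet> grad w (edge_mid N e) = n \<bullet> G e"
  using assms by (simp_all add: morley_local_def)

lemma ex1_same: "\<exists>!x. P x \<Longrightarrow> P a \<Longrightarrow> P b \<Longrightarrow> a = b"
  by blast

lemma morley_local_lin:
  assumes "morley_local N T f G u" "morley_local N T f' G' v"
  shows "morley_local N T (\<lambda>p. a * f p + f' p) (\<lambda>e. a *\<^sub>R G e + G' e) (\<lambda>x. a * u x + v x)"
  unfolding morley_local_def
proof (intro conjI ballI allI impI)
  note u = morley_localD[OF assms(1)] and v = morley_localD[OF assms(2)]
  show "quadratic (\<lambda>x. a * u x + v x)" by (rule quadratic_lin[OF u(1) v(1)])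
  show "a * u (pt N p) + v (pt N p) = a * f p + f' p" if "p \<in> T" for p
    using u(2)[OF that] v(2)[OF that] by simp
  show "n \<bullet> grad (\<lambda>x. a * u x + v x) (edge_mid N e) = n \<bullet> (a *\<^sub>R G e + G' e)"
    if "card e = 2 \<and> e \<subseteq> T \<and> unit_normal N e n" for e n
    using u(3)[of e n] v(3)[of e n] that by (simp add: grad_lin[OF u(1) v(1)] inner_add_right)
qed

lemma (in barycentric) morley_local_iff:
  "morley_local N T f G w \<longleftrightarrow> quadratic w \<and> (\<forall>p\<in>T. w (pt N p) = f p) \<and>
     (\<forall>r\<in>T. g r \<bullet> grad w (edge_mid N (T - {r})) = g r \<bullet> G (T - {r}))"
proof -
  have "(\<forall>e n. card e = 2 \<and> e \<subseteq> T \<and> unit_normal N e n \<longrightarrow> n \<bullet> grad w (edge_mid N e) = n \<bullet> G e)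
      \<longleftrightarrow> (\<forall>r\<in>T. \<forall>n. unit_normal N (T - {r}) n \<longrightarrow> n \<bullet> grad w (edge_mid N (T - {r})) = n \<bullet> G (T - {r}))"
    using edge_iff by (metis (no_types, lifting))
  also have "\<dots> \<longleftrightarrow> (\<forall>r\<in>T. g r \<bullet> grad w (edge_mid N (T - {r})) = g r \<bullet> G (T - {r}))"
    using normal_condition_iff by (intro ball_cong refl) blast
  finally show ?thesis by (simp add: morley_local_def)
qed

lemma (in barycentric) morley_local_unisolvent: "\<exists>!w. morley_local N T f G w"
proof (rule ex_ex1I)
  show "\<exists>w. morley_local N T f G w"
    using morley_local_ex[of f G] by (simp add: morley_local_iff)
  fix u v assume u: "morley_local N T f G u" and v: "morley_local N T f G v"
  have "morley_local N T (\<lambda>p. - 1 * f p + f p) (\<lambda>e. - 1 *\<^sub>R G e + G e) (\<lambda>x. - 1 * u x + v x)"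
    by (rule morley_local_lin[OF u v])
  then have "(\<lambda>x. - 1 * u x + v x) = (\<lambda>_. 0)"
    by (intro morley_local_zero) (simp_all add: morley_local_iff)
  then show "u = v" by (simp add: fun_eq_iff)
qed

section \<open>Global Morley interpolation and the recovered gradient\<close>

context mesh
begin

lemma morley_unisolvent:
  assumes "T \<in> \<T>"
  shows "\<exists>!w. morley_local N T f G w"
proof -
  obtain c g where "barycentric N T c g" using barycentric_ex[OF assms] by blast
  then show ?thesis by (rule barycentric.morley_local_unisolvent)
qed

lemma morley_space_quadratic: "w \<in> morley_space N \<T> \<Longrightarrow> T \<in> \<T> \<Longrightarrow> quadratic (w T)"
  unfolding morley_space_def by (elim CollectE conjE) (erule (1) bspec)

lemma morley_space_off: "w \<in> morley_space N \<T> \<Longrightarrow> T \<notin> \<T> \<Longrightarrow> w T = (\<lambda>_. 0)"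
  unfolding morley_space_def by (elim CollectE conjE, erule allE) (erule (1) mp)

text \<open>The continuity conditions of the Morley space cost nothing: \<open>avg_grad\<close> is
  attached to the edge rather than the triangle, so local solutions on both sides match
  automatically. Uniqueness then reduces to a single triangle.\<close>

lemma morley_interp_eqI:
  assumes "\<And>T. T \<in> \<T> \<Longrightarrow> morley_local N T (\<lambda>p. v (pt N p)) (avg_grad N \<T> v) (w T)"
    and "\<And>T. T \<notin> \<T> \<Longrightarrow> w T = (\<lambda>_. 0)"
  shows "morley_interp N \<T> v = w"
  unfolding morley_interp_def
proof (rule the_equality)
  note w = morley_localD[OF assms(1)]
  have "w \<in> morley_space N \<T>"
    unfolding morley_space_def mem_Collect_eq
  proof (intro conjI ballI allI impI)
    show "w S (pt N p) = w T (pt N p)" if "S \<in> \<T>" "T \<in> \<T>" "p \<in> S \<inter> T" for S T p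
      using w(2)[of S p] w(2)[of T p] that by simp
    show "n \<bullet> grad (w S) (edge_mid N e) = n \<bullet> grad (w T) (edge_mid N e)"
      if "S \<in> \<T>" "T \<in> \<T>" "card e = 2 \<and> e \<subseteq> S \<inter> T \<and> unit_normal N e n" for S T e n
      using w(3)[of S e n] w(3)[of T e n] that by simp
  qed (fact w(1) assms(2))+
  then show "w \<in> morley_space N \<T> \<and>
        (\<forall>T\<in>\<T>. \<forall>p\<in>T. w T (pt N p) = v (pt N p)) \<and>
        (\<forall>T\<in>\<T>. \<forall>e n. card e = 2 \<and> e \<subseteq> T \<and> unit_normal N e n \<longrightarrow>
           n \<bullet> grad (w T) (edge_mid N e) = n \<bullet> avg_grad N \<T> v e)"
    using w(2,3) by simp
  fix w' assume w': "w' \<in> morley_space N \<T> \<and>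
        (\<forall>T\<in>\<T>. \<forall>p\<in>T. w' T (pt N p) = v (pt N p)) \<and>
        (\<forall>T\<in>\<T>. \<forall>e n. card e = 2 \<and> e \<subseteq> T \<and> unit_normal N e n \<longrightarrow>
           n \<bullet> grad (w' T) (edge_mid N e) = n \<bullet> avg_grad N \<T> v e)"
  show "w' = w"
  proof
    fix T
    show "w' T = w T"
    proof (cases "T \<in> \<T>")
      case True
      have "morley_local N T (\<lambda>p. v (pt N p)) (avg_grad N \<T> v) (w' T)"
        unfolding morley_local_def
        using morley_space_quadratic[OF conjunct1[OF w'] True] bspec[OF conjunct1[OF conjunct2[OF w']] True]
          bspec[OF conjunct2[OF conjunct2[OF w']] True] by (intro conjI)
      then show ?thesis
        by (rule ex1_same[OF morley_unisolvent[OF True]]) (rule assms(1)[OF True])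
    next
      case False
      then show ?thesis using morley_space_off[OF conjunct1[OF w']] assms(2) by metis
    qed
  qed
qed

lemma morley_interp:
  "T \<in> \<T> \<Longrightarrow> morley_local N T (\<lambda>p. v (pt N p)) (avg_grad N \<T> v) (morley_interp N \<T> v T)"
  "T \<notin> \<T> \<Longrightarrow> morley_interp N \<T> v T = (\<lambda>_. 0)"
proof -
  define w where "w T = (if T \<in> \<T> then SOME u. morley_local N T (\<lambda>p. v (pt N p)) (avg_grad N \<T> v) u
    else (\<lambda>_. 0))" for T
  have w: "morley_local N T (\<lambda>p. v (pt N p)) (avg_grad N \<T> v) (w T)" if "T \<in> \<T>" for T
    using someI_ex[OF ex1_implies_ex[OF morley_unisolvent[OF that]]] that by (simp add: w_def)
  have "morley_interp N \<T> v = w"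
    by (rule morley_interp_eqI[OF w]) (simp_all add: w_def)
  then show "T \<in> \<T> \<Longrightarrow> morley_local N T (\<lambda>p. v (pt N p)) (avg_grad N \<T> v) (morley_interp N \<T> v T)"
    "T \<notin> \<T> \<Longrightarrow> morley_interp N \<T> v T = (\<lambda>_. 0)"
    using w by (simp_all add: w_def)
qed

lemma quadratic_morley_interp: "quadratic (morley_interp N \<T> v T)"
  using morley_interp[of T v] quadratic_zero unfolding morley_local_def by (cases "T \<in> \<T>") auto

text \<open>Only two-element sets \<open>e\<close> are compared, which provides the nonemptiness
  that \<open>avg_grad_lin\<close> asks for.\<close>

lemma morley_local_cong:
  assumes "morley_local N T f G w" "\<And>e. card e = 2 \<Longrightarrow> G e = G' e"
  shows "morley_local N T f G' w"
  using assms unfolding morley_local_def by simp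

lemma morley_interp_lin:
  assumes "u \<in> pl_space N \<T>" "v \<in> pl_space N \<T>"
  shows "morley_interp N \<T> (\<lambda>x. a * u x + v x)
           = (\<lambda>T x. a * morley_interp N \<T> u T x + morley_interp N \<T> v T x)"
proof (rule morley_interp_eqI)
  fix T assume "T \<in> \<T>"
  have "morley_local N T (\<lambda>p. a * u (pt N p) + v (pt N p)) (\<lambda>e. a *\<^sub>R avg_grad N \<T> u e + avg_grad N \<T> v e)
      (\<lambda>x. a * morley_interp N \<T> u T x + morley_interp N \<T> v T x)"
    by (rule morley_local_lin[OF morley_interp(1) morley_interp(1)]) fact+
  then show "morley_local N T (\<lambda>p. a * u (pt N p) + v (pt N p)) (avg_grad N \<T> (\<lambda>x. a * u x + v x))
      (\<lambda>x. a * morley_interp N \<T> u T x + morley_interp N \<T> v T x)"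
    by (rule morley_local_cong) (rule avg_grad_lin[OF assms, symmetric], auto)
qed (simp add: morley_interp)

lemma recovered_grad_lin:
  assumes "u \<in> pl_space N \<T>" "v \<in> pl_space N \<T>"
  shows "recovered_grad N \<T> (\<lambda>x. a * u x + v x) T x
           = a *\<^sub>R recovered_grad N \<T> u T x + recovered_grad N \<T> v T x"
  by (simp add: recovered_grad_def morley_interp_lin[OF assms] grad_lin quadratic_morley_interp)

text \<open>The local function is a polynomial on the whole plane, so its gradient has a continuous
  trace from either side of an edge.\<close>

lemma continuous_on_recovered_grad: "continuous_on A (recovered_grad N \<T> v T)"
  by (simp add: recovered_grad_def continuous_on_grad_quadratic quadratic_morley_interp)

lemma jump_lin:
  assumes "u \<in> pl_space N \<T>" "v \<in> pl_space N \<T>"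
  shows "jump N \<T> (\<lambda>x. a * u x + v x) e x = a *\<^sub>R jump N \<T> u e x + jump N \<T> v e x"
  by (simp add: jump_def recovered_grad_lin[OF assms] scaleR_right_diff_distrib)

lemma continuous_on_jump: "continuous_on A (jump N \<T> v e)"
  unfolding jump_def[abs_def] by (intro continuous_intros continuous_on_recovered_grad)

section \<open>Edge integrals and the penalty form\<close>

lemma integrable_on_edge:
  fixes H :: "real \<times> real \<Rightarrow> real"
  assumes "continuous_on UNIV H"
  shows "(\<lambda>t. H (linepath (edge_start N e) (edge_end N e) t)) integrable_on {0..1}"
  by (rule integrable_continuous_real, rule continuous_on_compose2[OF assms continuous_on_linepath]) simp

lemma edge_integral_lin:
  assumes "continuous_on UNIV F" "continuous_on UNIV G"
  shows "edge_integral N e (\<lambda>x. a * F x + G x) = a * edge_integral N e F + edge_integral N e G"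
proof -
  note int = integrable_on_edge[OF assms(1), of e] integrable_on_edge[OF assms(2), of e]
  show ?thesis
    unfolding edge_integral_def integral_add[OF integrable_on_mult_right[OF int(1)] int(2)]
    by (simp add: distrib_left)
qed

lemma penalty_form_nonneg: "penalty_form N \<T> v v \<ge> 0"
proof -
  have "continuous_on UNIV (\<lambda>x. jump N \<T> v e x \<bullet> jump N \<T> v e x)" for e
    by (intro continuous_on_inner continuous_on_jump)
  then show ?thesis
    unfolding penalty_form_def edge_integral_def edge_length_def
    by (intro sum_nonneg mult_nonneg_nonneg integral_nonneg integrable_on_edge) auto
qed

lemma penalty_form_lin:
  assumes "u \<in> pl_space N \<T>" "v \<in> pl_space N \<T>"
  shows "penalty_form N \<T> w (\<lambda>x. a * u x + v x) = a * penalty_form N \<T> w u + penalty_form N \<T> w v"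
proof -
  have "edge_integral N e (\<lambda>x. jump N \<T> w e x \<bullet> jump N \<T> (\<lambda>x. a * u x + v x) e x)
      = a * edge_integral N e (\<lambda>x. jump N \<T> w e x \<bullet> jump N \<T> u e x)
        + edge_integral N e (\<lambda>x. jump N \<T> w e x \<bullet> jump N \<T> v e x)" for e
    unfolding jump_lin[OF assms] inner_add_right inner_scaleR_right
    by (rule edge_integral_lin) (intro continuous_on_inner continuous_on_jump)+
  then show ?thesis
    by (simp add: penalty_form_def sum_distrib_left algebra_simps flip: sum.distrib)
qed

end

section \<open>Riesz representation and the energy identity\<close>

lemma grid_function_reduce:
  assumes "f \<in> grid_functions N"
  shows "f (i + a * int N, j + b * int N) = f (i, j)"
proof -
  have 1: "f (x + int k * int N, y) = f (x, y)" "f (x, y + int k * int N) = f (x, y)" for x y k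
  proof (induction k)
    case (Suc k)
    have "z + int (Suc k) * int N = (z + int k * int N) + int N" for z :: int
      by (simp add: algebra_simps)
    with Suc show "f (x + int (Suc k) * int N, y) = f (x, y)" "f (x, y + int (Suc k) * int N) = f (x, y)"
      using assms by (simp_all only: grid_functions_def mem_Collect_eq)
  qed simp_all
  have "f (x + a * int N, y) = f (x, y)" "f (x, y + a * int N) = f (x, y)" for x y a
    \<comment> \<open>Negative multiples follow from positive ones started at the shifted
      point.\<close>
    using 1[where x = x and y = y and k = "nat a"] 1(1)[where x = "x + a * int N" and k = "nat (- a)"]
      1(2)[where y = "y + a * int N" and k = "nat (- a)"]
    by (cases "a \<ge> 0"; simp)+
  then show ?thesis by simp
qed

definition cell_rep :: "nat \<Rightarrow> index \<Rightarrow> index" where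
  "cell_rep N p = (fst p mod int N, snd p mod int N)"

lemma cell_rep_in_cell: "N > 0 \<Longrightarrow> cell_rep N p \<in> cell N"
  by (simp add: cell_rep_def cell_def)

lemma cell_rep_cell: "p \<in> cell N \<Longrightarrow> cell_rep N p = p"
  by (auto simp: cell_rep_def cell_def)

lemma grid_function_cell_rep:
  assumes "f \<in> grid_functions N"
  shows "f (cell_rep N p) = f p"
  using grid_function_reduce[OF assms, of "fst p mod int N" "fst p div int N" "snd p mod int N" "snd p div int N"]
  by (simp add: cell_rep_def)

lemma cell_rep_comp_grid_function: "(\<lambda>p. F (cell_rep N p)) \<in> grid_functions N"
  by (simp add: grid_functions_def cell_rep_def)

lemma grid_functions_ext:
  assumes "N > 0" "f \<in> grid_functions N" "g \<in> grid_functions N" "\<And>p. p \<in> cell N \<Longrightarrow> f p = g p"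
  shows "f = g"
  using grid_function_cell_rep[OF assms(2)] grid_function_cell_rep[OF assms(3)] assms(4)[OF cell_rep_in_cell[OF assms(1)]]
  by (metis ext)

lemma spacing_pos: "N > 0 \<Longrightarrow> spacing N > 0"
  by (simp add: spacing_def)

definition grid_delta :: "nat \<Rightarrow> index \<Rightarrow> index \<Rightarrow> real" where
  "grid_delta N q p = of_bool (cell_rep N p = q)"

lemma grid_delta: "grid_delta N q \<in> grid_functions N"
  unfolding grid_delta_def by (rule cell_rep_comp_grid_function)

lemma grid_functions_lin:
  fixes f g :: "index \<Rightarrow> real"
  shows "f \<in> grid_functions N \<Longrightarrow> g \<in> grid_functions N \<Longrightarrow> (\<lambda>p. a * f p + g p) \<in> grid_functions N"
  by (simp add: grid_functions_def)

lemma grid_functions_zero: "(\<lambda>_. 0) \<in> grid_functions N"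
  by (simp add: grid_functions_def)

lemma grid_inner_delta:
  assumes "q \<in> cell N"
  shows "grid_inner N g (grid_delta N q) = (spacing N)\<^sup>2 * g q"
proof -
  have "(\<Sum>p\<in>cell N. g p \<bullet> grid_delta N q p) = (\<Sum>p\<in>cell N. if p = q then g p else 0)"
    by (intro sum.cong refl) (auto simp: grid_delta_def cell_rep_cell)
  then show ?thesis using assms by (simp add: grid_inner_def finite_cell)
qed

text \<open>The periodic nodal deltas form a basis that is orthogonal for the grid inner product,
  each of squared norm h^2; testing against them determines the representer.\<close>

theorem grid_riesz:
  fixes \<phi> :: "(index \<Rightarrow> real) \<Rightarrow> real"
  assumes N: "N > 0"
    and lin: "\<And>a u v. u \<in> grid_functions N \<Longrightarrow> v \<in> grid_functions N \<Longrightarrow> \<phi> (\<lambda>p. a * u p + v p) = a * \<phi> u + \<phi> v"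
  shows "\<exists>!g. g \<in> grid_functions N \<and> (\<forall>v\<in>grid_functions N. grid_inner N g v = \<phi> v)"
proof (rule ex_ex1I)
  let ?h = "(spacing N)\<^sup>2"
  have h: "?h \<noteq> 0" using spacing_pos[OF N] by simp
  have zero: "\<phi> (\<lambda>_. 0) = 0"
    using lin[OF grid_functions_zero grid_functions_zero, of 1] by simp
  have sum: "(\<lambda>p. \<Sum>q\<in>A. c q * grid_delta N q p) \<in> grid_functions N
      \<and> \<phi> (\<lambda>p. \<Sum>q\<in>A. c q * grid_delta N q p) = (\<Sum>q\<in>A. c q * \<phi> (grid_delta N q))" if "finite A" for A c
    using that
  proof (induction A)
    case empty
    then show ?case by (simp add: zero grid_functions_zero)
  next
    case (insert q A)
    then show ?case
      using lin[OF grid_delta, of "\<lambda>p. \<Sum>q\<in>A. c q * grid_delta N q p" "c q" q]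
        grid_functions_lin[OF grid_delta, of "\<lambda>p. \<Sum>q\<in>A. c q * grid_delta N q p" N "c q" q]
      by simp
  qed
  \<comment> \<open>Division by h^2 undoes the weight of the inner product. Passing through
    \<open>cell_rep\<close> makes the function periodic.\<close>
  define g where "g p = \<phi> (grid_delta N (cell_rep N p)) / ?h" for p
  have g: "g \<in> grid_functions N" unfolding g_def by (rule cell_rep_comp_grid_function)
  have "grid_inner N g v = \<phi> v" if v: "v \<in> grid_functions N" for v
  proof -
    have "v = (\<lambda>p. \<Sum>q\<in>cell N. v q * grid_delta N q p)"
    proof
      fix p
      have "(\<Sum>q\<in>cell N. v q * grid_delta N q p) = (\<Sum>q\<in>cell N. if q = cell_rep N p then v q else 0)"
        by (intro sum.cong refl) (auto simp: grid_delta_def)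
      then show "v p = (\<Sum>q\<in>cell N. v q * grid_delta N q p)"
        by (simp add: finite_cell cell_rep_in_cell[OF N] grid_function_cell_rep[OF v])
    qed
    then have "\<phi> v = (\<Sum>q\<in>cell N. v q * \<phi> (grid_delta N q))"
      using conjunct2[OF sum[OF finite_cell, of v N]] by simp
    also have "\<dots> = grid_inner N g v"
      using h by (simp add: grid_inner_def g_def sum_distrib_left cell_rep_cell mult.commute)
    finally show ?thesis ..
  qed
  with g show "\<exists>g. g \<in> grid_functions N \<and> (\<forall>v\<in>grid_functions N. grid_inner N g v = \<phi> v)" by blast
  fix g g' assume g: "g \<in> grid_functions N \<and> (\<forall>v\<in>grid_functions N. grid_inner N g v = \<phi> v)"
    and g': "g' \<in> grid_functions N \<and> (\<forall>v\<in>grid_functions N. grid_inner N g' v = \<phi> v)"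
  show "g = g'"
  proof (rule grid_functions_ext[OF N])
    fix p assume p: "p \<in> cell N"
    have "grid_inner N g (grid_delta N p) = grid_inner N g' (grid_delta N p)"
      using g g' grid_delta by metis
    then show "g p = g' p" using h by (simp add: grid_inner_delta[OF p])
  qed (use g g' in blast)+
qed

lemma (in mesh) grid_inner_penalty_op:
  assumes "u \<in> grid_functions N" "v \<in> grid_functions N"
  shows "grid_inner N (penalty_op N \<T> u) v = penalty_form N \<T> (pl_interp N \<T> u) (pl_interp N \<T> v)"
proof -
  have "\<exists>!g. g \<in> grid_functions N \<and> (\<forall>v\<in>grid_functions N.
      grid_inner N g v = penalty_form N \<T> (pl_interp N \<T> u) (pl_interp N \<T> v))"
    by (rule grid_riesz[OF N_pos]) (simp add: pl_interp_lin penalty_form_lin pl_interp)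
  from theI'[OF this] show ?thesis
    using assms(2) unfolding penalty_op_def by blast
qed

section \<open>Inner product identities and the Hall term\<close>

lemma grid_inner_add_left: "grid_inner N (\<lambda>p. f p + g p) h = grid_inner N f h + grid_inner N g h"
  by (simp add: grid_inner_def inner_add_left sum.distrib distrib_left)

lemma grid_inner_scaleR_left: "grid_inner N (\<lambda>p. a *\<^sub>R f p) h = a * grid_inner N f h"
  by (simp add: grid_inner_def sum_distrib_left mult.left_commute)

lemma grid_inner_commute: "grid_inner N f g = grid_inner N g f"
  by (simp add: grid_inner_def inner_commute)

lemma grid_norm_power2: "(grid_norm N f)\<^sup>2 = grid_inner N f f"
  by (simp add: grid_norm_def grid_inner_def sum_nonneg)

lemma component_componentwise: "component (componentwise F U) i = F (component U i)"
  by (simp add: component_def componentwise_def)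

lemma component_grid_functions: "U \<in> grid_functions N \<Longrightarrow> component U i \<in> grid_functions N"
  by (simp add: grid_functions_def component_def)

lemma grid_inner_componentwise:
  "grid_inner N (componentwise F U) V = (\<Sum>i\<in>UNIV. grid_inner N (F (component U i)) (component V i))"
  by (simp add: grid_inner_vec3 component_componentwise)

lemma component_discrete_curl:
  "component (discrete_curl Dx Dy U) 1 = Dy (component U 3)"
  "component (discrete_curl Dx Dy U) 2 = (\<lambda>p. - Dx (component U 3) p)"
  "component (discrete_curl Dx Dy U) 3 = (\<lambda>p. Dx (component U 2) p - Dy (component U 1) p)"
  by (simp_all add: component_def discrete_curl_def)

lemma grid_inner_diff_left: "grid_inner N (\<lambda>p. f p - g p) h = grid_inner N f h - grid_inner N g h"
  by (simp add: grid_inner_def inner_diff_left sum_subtractf right_diff_distrib)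

lemma grid_inner_minus_left: "grid_inner N (\<lambda>p. - f p) h = - grid_inner N f h"
  by (simp add: grid_inner_def sum_negf)

text \<open>As a 3 by 3 matrix of operators the curl is antisymmetric, with entries
  \<open>Dy\<close> and \<open>-Dx\<close> in the last column and their negatives in the last row.
  Its entries are skew-adjoint, so the two signs cancel.\<close>

lemma discrete_curl_symmetric:
  assumes "summation_by_parts N Dx" "summation_by_parts N Dy"
    "U \<in> grid_functions N" "V \<in> grid_functions N"
  shows "grid_inner N (discrete_curl Dx Dy U) V = grid_inner N U (discrete_curl Dx Dy V)"
proof -
  have sbp: "grid_inner N (D (component U i)) (component V j) = - grid_inner N (D (component V j)) (component U i)"
    if "summation_by_parts N D" for D i j
    using that component_grid_functions[OF assms(3)] component_grid_functions[OF assms(4)]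
    unfolding summation_by_parts_def by (metis grid_inner_commute)
  have "grid_inner N (discrete_curl Dx Dy U) V = grid_inner N (discrete_curl Dx Dy V) U"
    by (simp add: grid_inner_vec3 sum_3 component_discrete_curl grid_inner_diff_left grid_inner_minus_left
        sbp[OF assms(1)] sbp[OF assms(2)])
  then show ?thesis by (simp add: grid_inner_commute)
qed

lemma grid_functions_discrete_curl:
  assumes "grid_linear N Dx" "grid_linear N Dy" "U \<in> grid_functions N"
  shows "discrete_curl Dx Dy U \<in> grid_functions N"
proof -
  have "Dx (component U i) \<in> grid_functions N" "Dy (component U i) \<in> grid_functions N" for i
    using assms component_grid_functions unfolding grid_linear_def by blast+
  then show ?thesis by (simp add: grid_functions_def discrete_curl_def)
qed

lemma grid_inner_hall:
  assumes "grid_linear N Dx" "grid_linear N Dy" "summation_by_parts N Dx" "summation_by_parts N Dy"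
    "U \<in> grid_functions N" "V \<in> grid_functions N"
  shows "grid_inner N (hall Dx Dy U V) U = 0"
proof -
  let ?C = "discrete_curl Dx Dy U"
  \<comment> \<open>Summation by parts speaks only about periodic functions, so the product has to
    be recognized as one.\<close>
  have "(\<lambda>p. cross3 (?C p) (V p)) \<in> grid_functions N"
    using grid_functions_discrete_curl[OF assms(1,2,5)] assms(6) by (simp add: grid_functions_def)
  then have "grid_inner N (hall Dx Dy U V) U = grid_inner N (\<lambda>p. cross3 (?C p) (V p)) ?C"
    unfolding hall_def by (rule discrete_curl_symmetric[OF assms(3,4) _ assms(5)])
  also have "\<dots> = 0" by (simp add: grid_inner_def dot_cross_self)
  finally show ?thesis .
qed

theorem theorem3p3:
  fixes N :: nat
    and \<T> :: "index set set"
    and Dx Dy :: "(index \<Rightarrow> real) \<Rightarrow> (index \<Rightarrow> real)"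
    and \<alpha> \<sigma> \<tau> :: real
    and Bn Bstar Bnew :: "index \<Rightarrow> real ^ 3"
  assumes "N > 0" and "even N"
    and "periodic_triangulation N \<T>"
    and "grid_linear N Dx" and "grid_linear N Dy"
    and "summation_by_parts N Dx" and "summation_by_parts N Dy"
    and "1 < \<alpha>" and "\<alpha> \<le> 2" and "\<sigma> \<ge> 0" and "\<tau> > 0"
    and "Bn \<in> grid_functions N" and "Bstar \<in> grid_functions N"
    and "\<And>p. (Bstar p - Bn p) /\<^sub>R \<tau> + hall Dx Dy Bstar Bn p
             + componentwise (frac_laplacian N \<alpha>) Bstar p
             + \<sigma> *\<^sub>R componentwise (penalty_op N \<T>) Bstar p = 0"
    and "Bnew = div_projection N Bstar"
  shows "(grid_norm N Bstar)\<^sup>2 + (grid_norm N (\<lambda>p. Bstar p - Bn p))\<^sup>2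
           + 2 * \<tau> * (grid_norm N (componentwise (frac_laplacian N (\<alpha> / 2)) Bstar))\<^sup>2
           + 2 * \<tau> * \<sigma> * (\<Sum>i\<in>UNIV. penalty_form N \<T> (pl_interp N \<T> (component Bstar i))
                                                     (pl_interp N \<T> (component Bstar i)))
         = (grid_norm N Bn)\<^sup>2
       \<and> (grid_norm N Bnew)\<^sup>2
           + 2 * \<tau> * (grid_norm N (componentwise (frac_laplacian N (\<alpha> / 2)) Bstar))\<^sup>2
           + 2 * \<tau> * \<sigma> * (\<Sum>i\<in>UNIV. penalty_form N \<T> (pl_interp N \<T> (component Bstar i))
                                                     (pl_interp N \<T> (component Bstar i)))
         \<le> (grid_norm N Bn)\<^sup>2
       \<and> (grid_norm N Bnew)\<^sup>2 \<le> (grid_norm N Bn)\<^sup>2"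
proof -
  interpret mesh N \<T> using assms(1,3) by unfold_locales
  define L where "L = componentwise (frac_laplacian N \<alpha>) Bstar"
  define E where "E = componentwise (penalty_op N \<T>) Bstar"
  define K where "K = (grid_norm N (componentwise (frac_laplacian N (\<alpha> / 2)) Bstar))\<^sup>2"
  define b where "b = (\<Sum>i\<in>UNIV. penalty_form N \<T> (pl_interp N \<T> (component Bstar i))
    (pl_interp N \<T> (component Bstar i)))"
  \<comment> \<open>The scheme paired with \<open>Bstar\<close>, the argument at which the Hall term
    vanishes and both diffusion terms become squares.\<close>
  have "grid_inner N (\<lambda>p. inverse \<tau> *\<^sub>R (Bstar p - Bn p) + hall Dx Dy Bstar Bn p + L p + \<sigma> *\<^sub>R E p) Bstar
      = grid_inner N (\<lambda>_. 0) Bstar"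
    using assms(14) by (simp add: L_def E_def)
  moreover have "grid_inner N (\<lambda>_. 0) Bstar = 0" by (simp add: grid_inner_def)
  moreover have "grid_inner N L Bstar = K"
    by (simp add: L_def K_def grid_norm_power2 grid_inner_vec3 component_componentwise
        grid_inner_frac_laplacian[OF assms(1,2)])
  moreover have "grid_inner N E Bstar = b"
    by (simp add: E_def b_def grid_inner_componentwise grid_inner_penalty_op
        component_grid_functions[OF assms(13)])
  ultimately have "inverse \<tau> * grid_inner N (\<lambda>p. Bstar p - Bn p) Bstar + K + \<sigma> * b = 0"
    by (simp add: grid_inner_add_left grid_inner_scaleR_left grid_inner_hall[OF assms(4-7,13,12)])
  then have *: "grid_inner N (\<lambda>p. Bstar p - Bn p) Bstar + \<tau> * K + \<tau> * \<sigma> * b = 0"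
    using assms(11) by (simp add: field_simps)
  \<comment> \<open>The polarization identity, which produces the squared increment alongside the
    energy difference.\<close>
  have "2 * grid_inner N (\<lambda>p. Bstar p - Bn p) Bstar
      = grid_inner N Bstar Bstar + grid_inner N (\<lambda>p. Bstar p - Bn p) (\<lambda>p. Bstar p - Bn p) - grid_inner N Bn Bn"
    by (simp add: grid_inner_diff_left grid_inner_commute[of N _ "\<lambda>p. Bstar p - Bn p"]
        grid_inner_commute[of N Bn Bstar])
  with * have energy: "grid_inner N Bstar Bstar + grid_inner N (\<lambda>p. Bstar p - Bn p) (\<lambda>p. Bstar p - Bn p)
      + 2 * \<tau> * K + 2 * \<tau> * \<sigma> * b = grid_inner N Bn Bn"
    by (simp add: algebra_simps)
  have nonneg: "grid_inner N F F \<ge> 0" for F :: "index \<Rightarrow> real ^ 3"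
    by (simp flip: grid_norm_power2)
  have "K \<ge> 0" by (simp add: K_def)
  have "b \<ge> 0"
    unfolding b_def by (intro sum_nonneg penalty_form_nonneg)
  have proj: "grid_inner N Bnew Bnew \<le> grid_inner N Bstar Bstar"
    unfolding assms(15) by (rule grid_inner_div_projection_le[OF assms(1,2)])
  \<comment> \<open>Dropping the increment and using \<open>proj\<close> gives the dissipation
    inequality; dropping these two terms as well gives decay of the energy.\<close>
  have "0 \<le> 2 * \<tau> * K" "0 \<le> 2 * \<tau> * \<sigma> * b"
    using \<open>K \<ge> 0\<close> \<open>b \<ge> 0\<close> assms(10,11) by simp_all
  with energy proj nonneg[of "\<lambda>p. Bstar p - Bn p"] show ?thesis
    unfolding K_def[symmetric] b_def[symmetric] unfolding grid_norm_power2 by linarith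
qed

end
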